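(* Consider the random brickwork circuit $\mathbb U(t)$ on $2L$ qubits built from a fixed $U\in U(4)$ and independent uniformly random phases, with no conserved charges. Let the averaged gate $w$ of $U$ have non-negative parameters $a,b,c,d,e,f,g,\varepsilon_1,\varepsilon_2$, with either no splittings ($e=f=0$) or no mergers ($b=d=0$). Put $$\lambda=\frac14\Big((a+c)+\sqrt{4\varepsilon_1\varepsilon_2+(a-c)^2}\Big)^2$$ and assume $$\lambda\,\max\Big(1,\frac{g}{\varepsilon_1\varepsilon_2+ac}\Big)<1 .$$ Then, for large times, the generalised spectral form factor $K_g(t)=\mathbb E[|\mathrm{tr}\,\mathbb U(t)|^2]$ is fully determined by correlation functions of local observables: $$K_g(t)\simeq 1+K_g^{(1)}(t)\simeq 1+\lambda^t+(a^{2t}+c^{2t})\,L\,\delta_{t\bmod L},$$ where $\delta_0=1$ and $\delta_k=0$ for $k\ne0$. In particular, since $\lambda>\max(a^2,c^2)$, $$K_g(t)\simeq 1+e^{-t/\tau_{\rm th}},\qquad \tau_{\rm th}^{-1}=-\log\lambda ,$$ so that there is no $L$ dependence in $\tau_{\rm th}$.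
   Context: The symbol $\simeq$ denotes asymptotic equality for large times $t$, in the leading and subleading order (here: the constant $1$ and the leading correction to it). Sites: there are $2L$ qubits at positions $x\in\{0,\tfrac12,1,\dots,L-\tfrac12\}$ with periodic boundary conditions ($x$ taken mod $L$). One time step consists of two layers: first, two-qubit gates act on all pairs $(x+\tfrac12,x+1)$, then two-qubit gates act on all pairs $(x,x+\tfrac12)$, with $x\in\mathbb Z_L$. $\mathbb U(t)$ is the product of $t$ such time steps. Each gate has the form $(e^{i\phi\sigma^z}\otimes e^{i\phi'\sigma^z})\,U$ with $U\in U(4)$ a fixed matrix (first tensor factor = left site of the pair), where all the phases (two for each gate of each layer) are independent and uniform on $[-\pi,\pi]$; $\mathbb E$ is the expectation over the phases. In general the trace in the generalised spectral form factor is reduced to a common eigenspace of $\mathbb U(t)$ and all its commuting symmetries; in the absence of conserved charges it is the trace on $(\mathbb C^2)^{\otimes 2L}$. Averaged gate: write $s_\circ=\mathbb 1$, $s_\bullet=\sigma^z$. The averaged gate is the real $4\times4$ matrix with entries $w_{(\alpha\beta),(\gamma\delta)}=\tfrac14\mathrm{tr}\big[(s_\alpha\otimes s_\beta)\,U^\dagger\,(s_\gamma\otimes s_\delta)\,U\big]$, $\alpha,\beta,\gamma,\delta\in\{\circ,\bullet\}$. In the ordered basis $(\circ\circ,\circ\bullet,\bullet\circ,\bullet\bullet)$ it has the form $$w=\begin{pmatrix}1&0&0&0\\0&\varepsilon_1&a&b\\0&c&\varepsilon_2&d\\0&e&f&g\end{pmatrix},$$ with all parameters in $[-1,1]$. Two-point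 functions: $\langle\bullet_x|\bullet_y(t)\rangle_L=\mathbb E\big[2^{-2L}\mathrm{tr}(\sigma^z_x\,\mathbb U(t)^\dagger\sigma^z_y\,\mathbb U(t))\big]$, where $\sigma^z_x$ is the Pauli matrix $\sigma^z$ at site $x$, and $K^{(1)}_g(t)=\sum_x\langle\bullet_x|\bullet_x(t)\rangle_L$, the sum being over all $2L$ sites.
   Formalization: The formal version takes ε1, ε2 > 0 (else λ > max(a²,c²) fails), requires a + c > 0 for the formulas with λ^t (else K^(1) = 2Lλ^t), and g^(2L) < λ for claims on K_g (the fully occupied state adds g^(2Lt)); this last holds for all large L. *)

theory Defs
  imports
    "HOL-Probability.Probability"
    "HOL-Library.Landau_Symbols"
    "Jordan_Normal_Form.Schur_Decomposition"
begin

text \<open>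
  Site \<open>x \<in> {0, 1/2, \<dots>, L - 1/2}\<close> is numbered \<open>j = 2 x < 2 L\<close>. The computational basis
  of the \<open>2 L\<close> qubits is numbered by \<open>i < 2 ^ (2 L)\<close>, with site \<open>j\<close> in the \<open>+1\<close> (\<open>-1\<close>) eigenstate
  of \<open>\<sigma>\<^sup>z\<close> iff bit \<open>j\<close> of \<open>i\<close> is \<open>0\<close> (\<open>1\<close>).
\<close>

definition mat_trace :: "complex mat \<Rightarrow> complex" where
  "mat_trace A = (\<Sum>i<dim_row A. A $$ (i, i))"

definition unitary_mat :: "nat \<Rightarrow> complex mat \<Rightarrow> bool" where
  "unitary_mat n U \<longleftrightarrow> U \<in> carrier_mat n n \<and> mat_adjoint U * U = 1\<^sub>m n"

text \<open>In the two-qubit basis \<open>|00>, |01>, |10>, |11>\<close> the first tensor factor is the higher bit.\<close>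

definition tensor2 :: "complex mat \<Rightarrow> complex mat \<Rightarrow> complex mat" where
  "tensor2 A B = Matrix.mat 4 4
     (\<lambda>(i, k). A $$ (i div 2, k div 2) * B $$ (i mod 2, k mod 2))"

definition sigma_z :: "complex mat" where
  "sigma_z = mat_diag 2 (\<lambda>i. if i = 0 then 1 else - 1)"

text \<open>This is \<open>exp (i \<phi> \<sigma>\<^sup>z)\<close>.\<close>

definition z_rotation :: "real \<Rightarrow> complex mat" where
  "z_rotation \<phi> = mat_diag 2 (\<lambda>i. if i = 0 then cis \<phi> else cis (- \<phi>))"

definition gate :: "complex mat \<Rightarrow> real \<Rightarrow> real \<Rightarrow> complex mat" where
  "gate U \<phi> \<phi>' = tensor2 (z_rotation \<phi>) (z_rotation \<phi>') * U"

text \<open>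
  Layer \<open>0\<close> acts on the pairs \<open>(x + 1/2, x + 1)\<close>, layer \<open>1\<close> on the pairs \<open>(x, x + 1/2)\<close>, \<open>x < L\<close>.
\<close>

definition left_site :: "nat \<Rightarrow> nat \<Rightarrow> nat" where
  "left_site l x = (if l = 0 then 2 * x + 1 else 2 * x)"

definition right_site :: "nat \<Rightarrow> nat \<Rightarrow> nat \<Rightarrow> nat" where
  "right_site L l x = (left_site l x + 1) mod (2 * L)"

definition pair_state :: "nat \<Rightarrow> nat \<Rightarrow> nat \<Rightarrow> nat \<Rightarrow> nat" where
  "pair_state L l x i = 2 * of_bool (bit i (left_site l x)) + of_bool (bit i (right_site L l x))"

text \<open>
  The tensor product of the gates \<open>G x\<close>, \<open>x < L\<close>, on the \<open>L\<close> disjoint pairs of layer \<open>l\<close>.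
\<close>

definition brick_layer :: "nat \<Rightarrow> nat \<Rightarrow> (nat \<Rightarrow> complex mat) \<Rightarrow> complex mat" where
  "brick_layer L l G = Matrix.mat (2 ^ (2 * L)) (2 ^ (2 * L))
     (\<lambda>(i, k). \<Prod>x<L. G x $$ (pair_state L l x i, pair_state L l x k))"

text \<open>
  \<open>\<theta> (s, l, j)\<close> is the phase at site \<open>j\<close> in layer \<open>l\<close> of time step \<open>s\<close>. Every site belongs to
  exactly one gate of each layer, so this gives two phases for each gate of each layer.
\<close>

type_synonym phases = "nat \<times> nat \<times> nat \<Rightarrow> real"

definition random_layer :: "complex mat \<Rightarrow> nat \<Rightarrow> phases \<Rightarrow> nat \<Rightarrow> nat \<Rightarrow> complex mat" where
  "random_layer U L \<theta> s l =
     brick_layer L l (\<lambda>x. gate U (\<theta> (s, l, left_site l x)) (\<theta> (s, l, right_site L l x)))"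

primrec circuit :: "complex mat \<Rightarrow> nat \<Rightarrow> phases \<Rightarrow> nat \<Rightarrow> complex mat" where
  "circuit U L \<theta> 0 = 1\<^sub>m (2 ^ (2 * L))"
| "circuit U L \<theta> (Suc t) = random_layer U L \<theta> t 1 * random_layer U L \<theta> t 0 * circuit U L \<theta> t"

definition phase_measure :: "phases measure" where
  "phase_measure = Pi\<^sub>M UNIV (\<lambda>_. uniform_measure lborel {- pi..pi})"

text \<open>
  A conserved charge is an operator, not proportional to the identity, that commutes with the
  evolution for every choice of the phases. In its absence the trace in the generalised spectral
  form factor is the full trace.
\<close>

definition no_conserved_charges :: "complex mat \<Rightarrow> nat \<Rightarrow> bool" where
  "no_conserved_charges U L \<longleftrightarrow>
     (\<forall>Q \<in> carrier_mat (2 ^ (2 * L)) (2 ^ (2 * L)).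
        (\<forall>\<theta> t. Q * circuit U L \<theta> t = circuit U L \<theta> t * Q) \<longrightarrow>
        (\<exists>z. Q = z \<cdot>\<^sub>m 1\<^sub>m (2 ^ (2 * L))))"

definition spectral_form_factor :: "complex mat \<Rightarrow> nat \<Rightarrow> nat \<Rightarrow> real" where
  "spectral_form_factor U L t = (\<integral>\<theta>. (cmod (mat_trace (circuit U L \<theta> t)))\<^sup>2 \<partial>phase_measure)"

definition sigma_z_at :: "nat \<Rightarrow> nat \<Rightarrow> complex mat" where
  "sigma_z_at L j = mat_diag (2 ^ (2 * L)) (\<lambda>i. if bit i j then - 1 else 1)"

text \<open>
  The traces in the next definition and in the averaged gate are traces of products of two
  Hermitian matrices, hence real; \<open>Re\<close> only changes the type.
\<close>

definition two_point :: "complex mat \<Rightarrow> nat \<Rightarrow> nat \<Rightarrow> nat \<Rightarrow> nat \<Rightarrow> real" where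
  "two_point U L x y t =
     (\<integral>\<theta>. Re (mat_trace (sigma_z_at L x * mat_adjoint (circuit U L \<theta> t)
                * sigma_z_at L y * circuit U L \<theta> t)) / 2 ^ (2 * L) \<partial>phase_measure)"

definition one_point_sff :: "complex mat \<Rightarrow> nat \<Rightarrow> nat \<Rightarrow> real" where
  "one_point_sff U L t = (\<Sum>x<2 * L. two_point U L x x t)"

text \<open>The operators \<open>z_string 0, \<dots>, z_string 3\<close> are \<open>s\<^sub>\<alpha> \<otimes> s\<^sub>\<beta>\<close> in the ordered basis
  \<open>\<circ>\<circ>, \<circ>\<bullet>, \<bullet>\<circ>, \<bullet>\<bullet>\<close>.\<close>

definition z_string :: "nat \<Rightarrow> complex mat" where
  "z_string i = (let s = (\<lambda>k. if k = 0 then 1\<^sub>m 2 else sigma_z) in tensor2 (s (i div 2)) (s (i mod 2)))"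

definition averaged_gate :: "complex mat \<Rightarrow> real mat" where
  "averaged_gate U = Matrix.mat 4 4
     (\<lambda>(i, k). Re (mat_trace (z_string i * mat_adjoint U * z_string k * U)) / 4)"

text \<open>
  Asymptotic equality in the leading order, the constant \<open>1\<close>, and in the subleading order, the
  leading correction to \<open>1\<close>.
\<close>

definition asymp_eq_subleading :: "(nat \<Rightarrow> real) \<Rightarrow> (nat \<Rightarrow> real) \<Rightarrow> bool" (infix "\<simeq>" 50) where
  "f \<simeq> h \<longleftrightarrow> f \<longlonglongrightarrow> 1 \<and> h \<longlonglongrightarrow> 1 \<and> (\<lambda>t. f t - 1) \<sim>[at_top] (\<lambda>t. h t - 1)"

end

theory Submission
  imports Defs
begin

text \<open>
  Averaging over the phases after each layer projects the two replicas of the evolution onto equal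
  computational states. Hence \<open>K\<^sub>g(t)\<close> is the trace of the \<open>t\<close>-th power of a stochastic matrix,
  and in the basis of Pauli strings this matrix is a product over the pairs of \<open>w\<close>. Without
  splittings, or without mergers, it is block triangular in the number \<open>n\<close> of particles \<open>\<bullet>\<close>, so
  the trace is the sum of the traces over the blocks. The vacuum contributes \<open>1\<close> and the block
  \<open>n = 1\<close> contributes \<open>K\<^sub>g\<^sup>(\<^sup>1\<^sup>)(t)\<close>; the latter block has a positive eigenvector with eigenvalue
  \<open>\<lambda>\<close> and is primitive unless \<open>a = c = 0\<close>. For \<open>n \<ge> 2\<close> the product of the one-particle weights
  is a supersolution: each pair of particles meeting in a gate gains a factor \<open>g / \<lambda>\<close>, and in two
  consecutive layers at most \<open>n - 1\<close> pairs can meet (\<open>n\<close> if all sites are occupied). The growth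
  rate is therefore at most \<open>\<lambda>\<^sup>n\<close> if \<open>g \<le> \<lambda>\<close>, and otherwise at most \<open>\<lambda> g\<^sup>n\<^sup>-\<^sup>1\<close>, or
  \<open>g\<^sup>2\<^sup>L\<close> for \<open>n = 2 L\<close>. The hypothesis on \<open>\<lambda>\<close> gives \<open>g < 1\<close>, since
  \<open>\<epsilon>\<^sub>1 \<epsilon>\<^sub>2 + a c \<le> \<lambda>\<close>.
\<close>

subsection \<open>Sites and pairs\<close>

lemma left_site_lt: "x < L \<Longrightarrow> left_site l x < 2 * L"
  by (auto simp: left_site_def)

lemma right_site_lt: "x < L \<Longrightarrow> right_site L l x < 2 * L"
  by (auto simp: right_site_def)

lemma even_mod_double: "even (m mod (2 * L)) \<longleftrightarrow> even (m :: nat)"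
  by (simp add: dvd_mod_iff)

lemma even_left_site: "even (left_site l x) \<longleftrightarrow> l \<noteq> 0"
  by (simp add: left_site_def)

lemma even_right_site: "even (right_site L l x) \<longleftrightarrow> l = 0"
  by (simp add: right_site_def even_mod_double even_left_site)

lemma inj_on_left_site: "inj_on (left_site l) {..<L}"
  by (auto simp: inj_on_def left_site_def split: if_splits)

lemma inj_on_right_site: "inj_on (right_site L l) {..<L}"
proof (rule inj_onI)
  fix x y assume *: "x \<in> {..<L}" "y \<in> {..<L}" "right_site L l x = right_site L l y"
  show "x = y"
  proof (cases "l = 0")
    case False
    then show ?thesis using * by (auto simp: right_site_def left_site_def)
  next
    case True
    \<comment> \<open>The right site of layer 0 is \<open>2 * (x + 1)\<close> modulo
      \<open>2 * L\<close>; halving reduces the claim to indices modulo \<open>L\<close>, where only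
      \<open>x + 1 = L\<close> wraps around.\<close>
    then have "(2 * (x + 1)) mod (2 * L) = (2 * (y + 1)) mod (2 * L)"
      using * by (simp add: right_site_def left_site_def)
    then have "(x + 1) mod L = (y + 1) mod L"
      by (metis mult_mod_right mult_cancel1 zero_neq_numeral)
    then show ?thesis using *
      by (cases "x + 1 = L"; cases "y + 1 = L") auto
  qed
qed

text \<open>Left and right sites have opposite parity, so each image lies in one parity class. Each
  image has \<open>L\<close> elements and the two classes together have \<open>2 * L\<close>, which
  forces equality without exhibiting preimages.\<close>

lemma sites_image:
  assumes "0 < L"
  shows "left_site l ` {..<L} = {j \<in> {..<2 * L}. even j \<longleftrightarrow> l \<noteq> 0}" (is "?A = ?A'")
    and "right_site L l ` {..<L} = {j \<in> {..<2 * L}. even j \<longleftrightarrow> l = 0}" (is "?B = ?B'")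
proof -
  have sub: "?A \<subseteq> ?A'" "?B \<subseteq> ?B'"
    by (auto simp: left_site_lt right_site_lt even_left_site even_right_site)
  have "card ?A = L" "card ?B = L"
    by (auto simp: card_image inj_on_left_site inj_on_right_site)
  moreover have "card ?A' + card ?B' = 2 * L"
  proof -
    have "?A' \<union> ?B' = {..<2 * L}" "?A' \<inter> ?B' = {}" by auto
    then show ?thesis
      by (metis (no_types, lifting) card_Un_disjoint card_lessThan finite_Un finite_lessThan)
  qed
  moreover have "card ?A \<le> card ?A'" "card ?B \<le> card ?B'"
    using sub by (auto intro!: card_mono)
  ultimately have "card ?A = card ?A'" "card ?B = card ?B'" by linarith+
  then show "?A = ?A'" "?B = ?B'"
    using card_subset_eq[OF _ sub(1)] card_subset_eq[OF _ sub(2)] by simp_all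
qed

text \<open>The pairs of either layer tile the ring; this converts between quantities attached to
  sites and quantities attached to gates.\<close>

lemma prod_over_pairs:
  fixes f :: "nat \<Rightarrow> 'a::comm_monoid_mult"
  assumes "0 < L"
  shows "(\<Prod>j<2 * L. f j) = (\<Prod>x<L. f (left_site l x) * f (right_site L l x))"
proof -
  have "{..<2 * L} = left_site l ` {..<L} \<union> right_site L l ` {..<L}"
    "left_site l ` {..<L} \<inter> right_site L l ` {..<L} = {}"
    unfolding sites_image[OF assms] by auto
  then have "(\<Prod>j<2 * L. f j) = prod f (left_site l ` {..<L}) * prod f (right_site L l ` {..<L})"
    by (simp add: prod.union_disjoint)
  also have "\<dots> = (\<Prod>x<L. f (left_site l x)) * (\<Prod>x<L. f (right_site L l x))"
    by (simp add: prod.reindex inj_on_left_site inj_on_right_site)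
  finally show ?thesis by (simp add: prod.distrib)
qed

lemma sum_over_pairs:
  fixes f :: "nat \<Rightarrow> 'a::comm_monoid_add"
  assumes "0 < L"
  shows "(\<Sum>j<2 * L. f j) = (\<Sum>x<L. f (left_site l x) + f (right_site L l x))"
proof -
  have "{..<2 * L} = left_site l ` {..<L} \<union> right_site L l ` {..<L}"
    "left_site l ` {..<L} \<inter> right_site L l ` {..<L} = {}"
    unfolding sites_image[OF assms] by auto
  then have "(\<Sum>j<2 * L. f j) = sum f (left_site l ` {..<L}) + sum f (right_site L l ` {..<L})"
    by (simp add: sum.union_disjoint)
  also have "\<dots> = (\<Sum>x<L. f (left_site l x)) + (\<Sum>x<L. f (right_site L l x))"
    by (simp add: sum.reindex inj_on_left_site inj_on_right_site)
  finally show ?thesis by (simp add: sum.distrib)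
qed

lemma pair_state_lt: "pair_state L l x i < 4"
  by (auto simp: pair_state_def)

lemma bit_left_site: "bit i (left_site l x) \<longleftrightarrow> 2 \<le> pair_state L l x i"
  by (auto simp: pair_state_def)

lemma bit_right_site: "bit i (right_site L l x) \<longleftrightarrow> odd (pair_state L l x i)"
  by (auto simp: pair_state_def)

lemma nat_eq_if_low_bits_eq:
  fixes i k :: nat
  assumes "i < 2 ^ n" "k < 2 ^ n" "\<And>j. j < n \<Longrightarrow> bit i j = bit k j"
  shows "i = k"
proof -
  have "take_bit n i = take_bit n k"
    using assms(3) by (auto intro!: bit_eqI simp: bit_take_bit_iff)
  then show ?thesis using assms(1,2) by (simp add: take_bit_nat_eq_self)
qed

lemma eq_if_pair_states_eq:
  assumes "0 < L" "i < 2 ^ (2 * L)" "k < 2 ^ (2 * L)"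
    and "\<And>x. x < L \<Longrightarrow> pair_state L l x i = pair_state L l x k"
  shows "i = k"
proof (rule nat_eq_if_low_bits_eq[OF assms(2,3)])
  fix j assume "j < 2 * L"
  then have "j \<in> left_site l ` {..<L} \<union> right_site L l ` {..<L}"
    unfolding sites_image[OF assms(1)] by auto
  then show "bit i j = bit k j"
    using assms(4) by (auto simp: bit_left_site[where L = L] bit_right_site)
qed

text \<open>A basis state is the same as a free choice of pair states, so sums over states of
  products over pairs factorise. The layer computations below are thereby reduced to computations
  for one gate.\<close>

lemma sum_prod_pair_states:
  fixes f :: "nat \<Rightarrow> nat \<Rightarrow> 'a::comm_semiring_1"
  assumes "0 < L"
  shows "(\<Sum>i<2 ^ (2 * L). \<Prod>x<L. f x (pair_state L l x i)) = (\<Prod>x<L. \<Sum>r<4. f x r)"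
proof -
  let ?h = "\<lambda>i. \<lambda>x\<in>{..<L}. pair_state L l x i"
  let ?P = "PiE {..<L} (\<lambda>_. {..<4::nat})"
  have inj: "inj_on ?h {..<2 ^ (2 * L)}"
  proof (rule inj_onI)
    fix i k assume *: "i \<in> {..<2 ^ (2 * L)}" "k \<in> {..<2 ^ (2 * L)}" "?h i = ?h k"
    have "pair_state L l x i = pair_state L l x k" if "x < L" for x
      using fun_cong[OF *(3), of x] that by simp
    then show "i = k" using * eq_if_pair_states_eq[OF assms, of i k l] by simp
  qed
  have "?h ` {..<2 ^ (2 * L)} \<subseteq> ?P"
    by (auto simp: pair_state_lt PiE_iff extensional_def split: if_splits)
  moreover have "card (?h ` {..<2 ^ (2 * L)}) = card ?P"
    unfolding card_image[OF inj] by (simp add: card_PiE power_mult)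
  ultimately have "?h ` {..<2 ^ (2 * L)} = ?P"
    by (intro card_subset_eq) (auto intro: finite_PiE)
  then have "(\<Sum>g\<in>?P. \<Prod>x<L. f x (g x)) = (\<Sum>i<2 ^ (2 * L). \<Prod>x<L. f x (?h i x))"
    using sum.reindex[OF inj, of "\<lambda>g. \<Prod>x<L. f x (g x)"] by simp
  then show ?thesis by (simp add: prod_sum_PiE)
qed

subsection \<open>Averaging over the phases\<close>

lemma prob_space_uniform_phase: "prob_space (uniform_measure lborel {- pi..pi})"
  by (rule prob_space_uniform_measure) auto

lemma borel_measurable_cis_mult: "(\<lambda>x. cis (c * x)) \<in> borel_measurable borel"
  by (intro borel_measurable_continuous_onI continuous_intros)

lemma integral_cis_uniform:
  fixes n :: int
  shows "(\<integral>x. cis (of_int n * x) \<partial>uniform_measure lborel {- pi..pi}) = of_bool (n = 0)"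
proof -
  have meas: "uniform_measure lborel {- pi..pi}
      = density lborel (\<lambda>x. ennreal (indicator {- pi..pi} x / (2 * pi)))"
    unfolding uniform_measure_def
    using divide_ennreal[of 1 "2 * pi"] by (intro density_cong) (auto simp: indicator_def)
  have "(\<integral>x. cis (of_int n * x) \<partial>uniform_measure lborel {- pi..pi})
      = (\<integral>x. (indicator {- pi..pi} x / (2 * pi)) *\<^sub>R cis (of_int n * x) \<partial>lborel)"
    unfolding meas by (rule integral_density) (auto simp: borel_measurable_cis_mult)
  also have "\<dots> = (\<integral>x. (1 / (2 * pi)) *\<^sub>R (indicator {- pi..pi} x *\<^sub>R cis (of_int n * x)) \<partial>lborel)"
    by (rule Bochner_Integration.integral_cong) auto
  also have "\<dots> = (1 / (2 * pi)) *\<^sub>R (\<integral>x. indicator {- pi..pi} x *\<^sub>R cis (of_int n * x) \<partial>lborel)"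
    by (rule integral_scaleR_right)
  also have "(\<integral>x. indicator {- pi..pi} x *\<^sub>R cis (of_int n * x) \<partial>lborel)
      = (if n = 0 then of_real (2 * pi) else 0)"
  proof (cases "n = 0")
    case True
    then show ?thesis by (simp add: scaleR_conv_of_real)
  next
    case False
    let ?F = "\<lambda>x. - (\<i> / of_int n) * cis (of_int n * x)"
    have "(\<integral>x. indicator {- pi..pi} x *\<^sub>R cis (of_int n * x) \<partial>lborel) = ?F pi - ?F (- pi)"
    proof (rule integral_FTC_Icc)
      fix x
      show "(?F has_vector_derivative cis (of_int n * x)) (at x within {- pi..pi})"
        using False unfolding cis_conv_exp
        by (auto intro!: derivative_eq_intros has_vector_derivative_real_field simp: field_simps)
    qed (auto intro!: continuous_intros)
    \<comment> \<open>The antiderivative takes equal values at both endpoints because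
      \<open>sin\<close> vanishes at integer multiples of \<open>pi\<close>.\<close>
    moreover have "cis (of_int n * pi) = cis (- (of_int n * pi))"
      by (simp add: complex_eq_iff sin_int_times_real mult.commute)
    ultimately show ?thesis using False by simp
  qed
  finally show ?thesis by (simp add: scaleR_conv_of_real)
qed

text \<open>Only finitely many phases enter, so the infinite product measure may be replaced by its
  marginal on \<open>F\<close>. There the integral factorises, and each factor vanishes unless its
  exponent is zero.\<close>

lemma has_bochner_integral_character:
  fixes n :: "nat \<times> nat \<times> nat \<Rightarrow> int"
  assumes "finite F"
  shows "has_bochner_integral phase_measure (\<lambda>\<theta>. \<Prod>p\<in>F. cis (of_int (n p) * \<theta> p))
    (of_bool (\<forall>p\<in>F. n p = 0))"
proof -
  let ?M = "\<lambda>_ :: nat \<times> nat \<times> nat. uniform_measure lborel {- pi..pi}"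
  interpret product_prob_space ?M UNIV
    by (intro product_prob_spaceI prob_space_uniform_phase)
  have int: "integrable (?M p) (\<lambda>x. cis (of_int (n p) * x))" for p
  proof (rule finite_measure.integrable_const_bound[where B = 1])
    show "(\<lambda>x. cis (of_int (n p) * x)) \<in> borel_measurable (?M p)"
      by (simp add: borel_measurable_cis_mult cong: measurable_cong_sets)
  qed (auto simp: prob_space_uniform_phase prob_space.axioms(1))
  have distr: "distr phase_measure (Pi\<^sub>M F ?M) (\<lambda>x. restrict x F) = Pi\<^sub>M F ?M"
    unfolding phase_measure_def using assms by (intro distr_PiM_restrict_finite) auto
  have meas: "(\<lambda>x. restrict x F) \<in> measurable phase_measure (Pi\<^sub>M F ?M)"
    unfolding phase_measure_def by (rule measurable_restrict_subset) simp
  have "integrable (Pi\<^sub>M F ?M) (\<lambda>\<theta>. \<Prod>p\<in>F. cis (of_int (n p) * \<theta> p))"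
    by (rule product_integrable_prod[OF assms]) (rule int)
  moreover have "(\<integral>\<theta>. (\<Prod>p\<in>F. cis (of_int (n p) * \<theta> p)) \<partial>Pi\<^sub>M F ?M)
      = (\<Prod>p\<in>F. of_bool (n p = 0))"
    by (subst product_integral_prod[OF assms]) (auto simp: int integral_cis_uniform)
  ultimately have integral: "has_bochner_integral (Pi\<^sub>M F ?M) (\<lambda>\<theta>. \<Prod>p\<in>F. cis (of_int (n p) * \<theta> p))
      (of_bool (\<forall>p\<in>F. n p = 0))"
    using assms by (simp add: has_bochner_integral_iff)
  then have "has_bochner_integral (distr phase_measure (Pi\<^sub>M F ?M) (\<lambda>x. restrict x F))
      (\<lambda>\<theta>. \<Prod>p\<in>F. cis (of_int (n p) * \<theta> p)) (of_bool (\<forall>p\<in>F. n p = 0))"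
    unfolding distr .
  then have "has_bochner_integral phase_measure
      (\<lambda>\<theta>. \<Prod>p\<in>F. cis (of_int (n p) * restrict \<theta> F p)) (of_bool (\<forall>p\<in>F. n p = 0))"
    using borel_measurable_has_bochner_integral[OF integral] meas
    by (simp only: has_bochner_integral_iff integrable_distr_eq integral_distr)
  moreover have "(\<Prod>p\<in>F. cis (of_int (n p) * restrict \<theta> F p)) = (\<Prod>p\<in>F. cis (of_int (n p) * \<theta> p))" for \<theta>
    by (rule prod.cong) auto
  ultimately show ?thesis by (simp only:)
qed

section \<open>Phase characters and moments of two replicas\<close>

definition layer_amplitude :: "complex mat \<Rightarrow> nat \<Rightarrow> nat \<Rightarrow> nat \<Rightarrow> nat \<Rightarrow> complex" where
  "layer_amplitude U L l i k = (\<Prod>x<L. U $$ (pair_state L l x i, pair_state L l x k))"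

definition spin :: "nat \<Rightarrow> nat \<Rightarrow> int" where
  "spin i j = (if bit i j then - 1 else 1)"

lemma mult_mat_entry:
  fixes A B :: "'a::semiring_0 mat"
  assumes "A \<in> carrier_mat n n" "B \<in> carrier_mat n n" "i < n" "j < n"
  shows "(A * B) $$ (i, j) = (\<Sum>k<n. A $$ (i, k) * B $$ (k, j))"
  using assms by (simp add: scalar_prod_def atLeast0LessThan)

lemma gate_entry:
  assumes "U \<in> carrier_mat 4 4" "r < 4" "s < 4"
  shows "gate U \<phi> \<phi>' $$ (r, s)
    = cis ((if 2 \<le> r then - 1 else 1) * \<phi>) * cis ((if odd r then - 1 else 1) * \<phi>') * U $$ (r, s)"
proof -
  have diag: "z_rotation \<psi> $$ (u, v) = (if u = v then cis ((if u = 0 then 1 else - 1) * \<psi>) else 0)"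
    if "u < 2" "v < 2" for \<psi> u v
    using that by (simp add: z_rotation_def mat_diag_def)
  have tensor: "tensor2 (z_rotation \<phi>) (z_rotation \<phi>') $$ (r, q) = (if q = r then
      cis ((if 2 \<le> r then - 1 else 1) * \<phi>) * cis ((if odd r then - 1 else 1) * \<phi>') else 0)"
    if "q < 4" for q
  proof (cases "q = r")
    case True
    then show ?thesis using that by (auto simp: tensor2_def diag odd_iff_mod_2_eq_one)
  next
    case False
    then have "r div 2 \<noteq> q div 2 \<or> r mod 2 \<noteq> q mod 2"
      by (metis div_mult_mod_eq)
    then show ?thesis using that assms(2) False by (auto simp: tensor2_def diag)
  qed
  have "gate U \<phi> \<phi>' $$ (r, s) = (\<Sum>q<4. tensor2 (z_rotation \<phi>) (z_rotation \<phi>') $$ (r, q) * U $$ (q, s))"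
    unfolding gate_def using assms by (intro mult_mat_entry) (auto simp: tensor2_def)
  also have "\<dots> = (\<Sum>q<4. if q = r then
      cis ((if 2 \<le> r then - 1 else 1) * \<phi>) * cis ((if odd r then - 1 else 1) * \<phi>') * U $$ (q, s) else 0)"
    by (intro sum.cong refl) (simp add: tensor)
  also have "\<dots> = cis ((if 2 \<le> r then - 1 else 1) * \<phi>) * cis ((if odd r then - 1 else 1) * \<phi>') * U $$ (r, s)"
    using assms(2) by (simp add: sum.delta)
  finally show ?thesis .
qed

text \<open>The rotations are diagonal and stand to the left of \<open>U\<close>, so the phases
  enter only through a character fixed by the outgoing state \<open>i\<close>. Averaging will
  therefore compare the outgoing states of the two replicas.\<close>

lemma random_layer_entry:
  assumes "0 < L" "U \<in> carrier_mat 4 4" "i < 2 ^ (2 * L)" "k < 2 ^ (2 * L)"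
  shows "random_layer U L \<theta> s l $$ (i, k)
    = (\<Prod>j<2 * L. cis (of_int (spin i j) * \<theta> (s, l, j))) * layer_amplitude U L l i k"
proof -
  have "random_layer U L \<theta> s l $$ (i, k)
    = (\<Prod>x<L. gate U (\<theta> (s, l, left_site l x)) (\<theta> (s, l, right_site L l x))
        $$ (pair_state L l x i, pair_state L l x k))"
    using assms by (simp add: random_layer_def brick_layer_def)
  also have "\<dots> = (\<Prod>x<L. cis (of_int (spin i (left_site l x)) * \<theta> (s, l, left_site l x))
      * cis (of_int (spin i (right_site L l x)) * \<theta> (s, l, right_site L l x))
      * U $$ (pair_state L l x i, pair_state L l x k))"
    using assms(2)
    by (intro prod.cong refl)
       (simp add: gate_entry pair_state_lt spin_def bit_left_site[where L = L] bit_right_site)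
  also have "\<dots> = (\<Prod>j<2 * L. cis (of_int (spin i j) * \<theta> (s, l, j))) * layer_amplitude U L l i k"
    by (simp add: prod.distrib layer_amplitude_def
        prod_over_pairs[OF assms(1), of "\<lambda>j. cis (of_int (spin i j) * \<theta> (s, l, j))" l])
  finally show ?thesis .
qed

lemma random_layer_carrier: "random_layer U L \<theta> s l \<in> carrier_mat (2 ^ (2 * L)) (2 ^ (2 * L))"
  by (simp add: random_layer_def brick_layer_def)

lemma circuit_carrier: "circuit U L \<theta> t \<in> carrier_mat (2 ^ (2 * L)) (2 ^ (2 * L))"
  by (induction t) (auto intro: random_layer_carrier mult_carrier_mat)

lemma circuit_Suc_entry:
  assumes "i < 2 ^ (2 * L)" "j < 2 ^ (2 * L)"
  shows "circuit U L \<theta> (Suc t) $$ (i, j) = (\<Sum>k<2 ^ (2 * L). \<Sum>m<2 ^ (2 * L).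
    random_layer U L \<theta> t 1 $$ (i, m) * random_layer U L \<theta> t 0 $$ (m, k)
      * circuit U L \<theta> t $$ (k, j))"
proof -
  note carrier = random_layer_carrier circuit_carrier
  have "circuit U L \<theta> (Suc t) $$ (i, j) = (\<Sum>k<2 ^ (2 * L).
      (random_layer U L \<theta> t 1 * random_layer U L \<theta> t 0) $$ (i, k) * circuit U L \<theta> t $$ (k, j))"
    unfolding circuit.simps
    by (rule mult_mat_entry[OF mult_carrier_mat[OF carrier(1,1)] carrier(2) assms])
  also have "\<dots> = (\<Sum>k<2 ^ (2 * L). \<Sum>m<2 ^ (2 * L).
    random_layer U L \<theta> t 1 $$ (i, m) * random_layer U L \<theta> t 0 $$ (m, k)
      * circuit U L \<theta> t $$ (k, j))"
    by (intro sum.cong refl, subst mult_mat_entry[OF carrier(1,1) assms(1)])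
      (simp_all add: sum_distrib_right)
  finally show ?thesis .
qed

text \<open>\<open>spin_shift\<close> extends the exponents \<open>n\<close> of a character by those of the phases that step \<open>t\<close>
  puts on a pair of replica paths through \<open>(m, m')\<close> and \<open>(i, i')\<close>.\<close>

definition spin_shift :: "nat \<Rightarrow> nat \<Rightarrow> nat \<Rightarrow> nat \<Rightarrow> nat \<Rightarrow> (nat \<times> nat \<times> nat \<Rightarrow> int) \<Rightarrow> nat \<times> nat \<times> nat \<Rightarrow> int" where
  "spin_shift t i i' m m' n = (\<lambda>(s, l, j).
     if s = t then (if l = 0 then spin m j - spin m' j else spin i j - spin i' j) else n (s, l, j))"

text \<open>The expectation of an entry of the circuit times a conjugate entry. The factor
  \<open>of_bool\<close> is what the phase average of one step leaves: both replicas must agree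
  after layer 0 and after layer 1.\<close>

primrec replica_moment :: "complex mat \<Rightarrow> nat \<Rightarrow> nat \<Rightarrow> nat \<Rightarrow> nat \<Rightarrow> nat \<Rightarrow> nat \<Rightarrow> complex" where
  "replica_moment U L 0 i i' j j' = of_bool (i = j \<and> i' = j')"
| "replica_moment U L (Suc t) i i' j j' =
    (\<Sum>k<2 ^ (2 * L). \<Sum>k'<2 ^ (2 * L). \<Sum>m<2 ^ (2 * L). \<Sum>m'<2 ^ (2 * L).
       layer_amplitude U L 1 i m * layer_amplitude U L 0 m k
         * cnj (layer_amplitude U L 1 i' m' * layer_amplitude U L 0 m' k')
         * (of_bool (i = i' \<and> m = m') * replica_moment U L t k k' j j'))"

lemma spin_eq_iff:
  assumes "i < 2 ^ n" "i' < 2 ^ n"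
  shows "(\<forall>j<n. spin i j - spin i' j = 0) \<longleftrightarrow> i = i'"
  using nat_eq_if_low_bits_eq[OF assms] by (auto simp: spin_def split: if_splits)

text \<open>The additional character in phases of later steps makes the induction go through without an
  appeal to the independence of the steps.\<close>

lemma has_bochner_integral_circuit_pair:
  fixes n :: "nat \<times> nat \<times> nat \<Rightarrow> int"
  assumes L: "0 < L" and U: "U \<in> carrier_mat 4 4"
    and j: "j < 2 ^ (2 * L)" "j' < 2 ^ (2 * L)"
  shows "\<lbrakk>finite F; \<And>p. p \<in> F \<Longrightarrow> t \<le> fst p; i < 2 ^ (2 * L); i' < 2 ^ (2 * L)\<rbrakk> \<Longrightarrow>
    has_bochner_integral phase_measure
      (\<lambda>\<theta>. (\<Prod>p\<in>F. cis (of_int (n p) * \<theta> p))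
        * (circuit U L \<theta> t $$ (i, j) * cnj (circuit U L \<theta> t $$ (i', j'))))
      (of_bool (\<forall>p\<in>F. n p = 0) * replica_moment U L t i i' j j')"
proof (induction t arbitrary: F n i i')
  case 0
  have "has_bochner_integral phase_measure
      (\<lambda>\<theta>. of_bool (i = j \<and> i' = j') * (\<Prod>p\<in>F. cis (of_int (n p) * \<theta> p)))
      (of_bool (i = j \<and> i' = j') * of_bool (\<forall>p\<in>F. n p = 0))"
    using 0 by (intro has_bochner_integral_mult_right has_bochner_integral_character)
  moreover have "circuit U L \<theta> 0 $$ (i, j) * cnj (circuit U L \<theta> 0 $$ (i', j')) = of_bool (i = j \<and> i' = j')" for \<theta>
    using 0 j by simp
  ultimately show ?case by (simp only: replica_moment.simps mult.commute)
next
  case (Suc t)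
  let ?N = "2 ^ (2 * L) :: nat" and ?A = "layer_amplitude U L"
  \<comment> \<open>\<open>?F'\<close> adds to \<open>F\<close> the phases of step \<open>t\<close>
    in both layers, so the induction hypothesis applies with an enlarged character.\<close>
  let ?F' = "F \<union> {t} \<times> {0, 1} \<times> {..<2 * L}"
  let ?char = "\<lambda>F n \<theta>. \<Prod>p\<in>F. cis (of_int (n p) * \<theta> p)"
  let ?c = "\<lambda>k m k' m'. ?A 1 i m * ?A 0 m k * cnj (?A 1 i' m' * ?A 0 m' k')"
  have F: "p \<in> F \<Longrightarrow> fst p \<noteq> t" for p using Suc.prems(2)[of p] by auto
  then have disj: "F \<inter> {t} \<times> {0, 1} \<times> {..<2 * L} = {}" by fastforce
  have char: "?char ?F' (spin_shift t i i' m m' n) \<theta> = ?char F n \<theta>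
      * ((\<Prod>j<2 * L. cis (of_int (spin i j) * \<theta> (t, 1, j))) * cnj (\<Prod>j<2 * L. cis (of_int (spin i' j) * \<theta> (t, 1, j))))
      * ((\<Prod>j<2 * L. cis (of_int (spin m j) * \<theta> (t, 0, j))) * cnj (\<Prod>j<2 * L. cis (of_int (spin m' j) * \<theta> (t, 0, j))))"
    for m m' \<theta>
  proof -
    have "?char F (spin_shift t i i' m m' n) \<theta> = ?char F n \<theta>"
      using F by (intro prod.cong refl) (force simp: spin_shift_def split: prod.splits)
    moreover have "?char ({t} \<times> {0, 1} \<times> {..<2 * L}) (spin_shift t i i' m m' n) \<theta>
      = (\<Prod>j<2 * L. cis (of_int (spin m j - spin m' j) * \<theta> (t, 0, j)))
        * (\<Prod>j<2 * L. cis (of_int (spin i j - spin i' j) * \<theta> (t, 1, j)))"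
      by (simp add: prod.Sigma[symmetric] prod.cartesian_product' spin_shift_def)
    moreover have "(\<Prod>j<2 * L. cis (of_int (spin a j - spin b j) * \<theta> (t, l, j)))
      = (\<Prod>j<2 * L. cis (of_int (spin a j) * \<theta> (t, l, j))) * cnj (\<Prod>j<2 * L. cis (of_int (spin b j) * \<theta> (t, l, j)))"
      for a b l
      by (simp add: prod.distrib[symmetric] cis_cnj cis_mult left_diff_distrib)
    ultimately show ?thesis
      using Suc.prems(1) disj by (simp add: prod.union_disjoint mult_ac)
  qed
  have expand: "?char F n \<theta> * (circuit U L \<theta> (Suc t) $$ (i, j) * cnj (circuit U L \<theta> (Suc t) $$ (i', j')))
    = (\<Sum>k<?N. \<Sum>k'<?N. \<Sum>m<?N. \<Sum>m'<?N. ?c k m k' m' * (?char ?F' (spin_shift t i i' m m' n) \<theta>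
        * (circuit U L \<theta> t $$ (k, j) * cnj (circuit U L \<theta> t $$ (k', j')))))" for \<theta>
    unfolding circuit_Suc_entry[OF Suc.prems(3) j(1)] circuit_Suc_entry[OF Suc.prems(4) j(2)]
      char cnj_sum sum_product
    unfolding sum_distrib_left
    using Suc.prems(3,4)
    by (intro sum.cong refl) (simp add: random_layer_entry[OF L U] mult_ac)
  have "has_bochner_integral phase_measure
      (\<lambda>\<theta>. ?c k m k' m' * (?char ?F' (spin_shift t i i' m m' n) \<theta>
        * (circuit U L \<theta> t $$ (k, j) * cnj (circuit U L \<theta> t $$ (k', j')))))
      (of_bool (\<forall>p\<in>F. n p = 0)
        * (?c k m k' m' * (of_bool (i = i' \<and> m = m') * replica_moment U L t k k' j j')))"
    if "k < ?N" "m < ?N" "k' < ?N" "m' < ?N" for k m k' m'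
  proof -
    \<comment> \<open>On the new phases the exponents vanish exactly when the spins of the replicas
      agree at every site, that is, when the states coincide.\<close>
    have "(\<forall>p\<in>?F'. spin_shift t i i' m m' n p = 0) \<longleftrightarrow> (\<forall>p\<in>F. n p = 0)
      \<and> (\<forall>j<2 * L. spin m j - spin m' j = 0) \<and> (\<forall>j<2 * L. spin i j - spin i' j = 0)"
      using F unfolding ball_Un by (fastforce simp: spin_shift_def)
    then have eq: "(\<forall>p\<in>?F'. spin_shift t i i' m m' n p = 0) \<longleftrightarrow> (\<forall>p\<in>F. n p = 0) \<and> i = i' \<and> m = m'"
      unfolding spin_eq_iff[OF Suc.prems(3,4)] spin_eq_iff[OF that(2,4)] by blast
    have "has_bochner_integral phase_measure
      (\<lambda>\<theta>. ?c k m k' m' * (?char ?F' (spin_shift t i i' m m' n) \<theta>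
        * (circuit U L \<theta> t $$ (k, j) * cnj (circuit U L \<theta> t $$ (k', j')))))
      (?c k m k' m' * (of_bool (\<forall>p\<in>?F'. spin_shift t i i' m m' n p = 0) * replica_moment U L t k k' j j'))"
      using Suc.prems that by (intro has_bochner_integral_mult_right Suc.IH) (auto dest: Suc_leD)
    then show ?thesis unfolding eq by (simp add: of_bool_conj mult_ac)
  qed
  then show ?case
    unfolding expand replica_moment.simps sum_distrib_left
    by (intro has_bochner_integral_sum) auto
qed

section \<open>Classical transition probabilities of the averaged evolution\<close>

definition layer_prob :: "complex mat \<Rightarrow> nat \<Rightarrow> nat \<Rightarrow> nat \<Rightarrow> nat \<Rightarrow> real" where
  "layer_prob U L l i k = (cmod (layer_amplitude U L l i k))\<^sup>2"

primrec circuit_prob :: "complex mat \<Rightarrow> nat \<Rightarrow> nat \<Rightarrow> nat \<Rightarrow> nat \<Rightarrow> real" where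
  "circuit_prob U L 0 i j = of_bool (i = j)"
| "circuit_prob U L (Suc t) i j = (\<Sum>k<2 ^ (2 * L). \<Sum>m<2 ^ (2 * L).
     layer_prob U L 1 i m * layer_prob U L 0 m k * circuit_prob U L t k j)"

lemma replica_moment_Suc_neq: "i \<noteq> i' \<Longrightarrow> replica_moment U L (Suc t) i i' j j' = 0"
  by simp

text \<open>Two replicas that start in the same state and are forced to agree after every layer
  follow the same path, so amplitudes pair up into squared moduli.\<close>

lemma replica_moment_same_column:
  "replica_moment U L t i i' j j = of_bool (i = i') * of_real (circuit_prob U L t i j)"
proof (induction t arbitrary: i i')
  case 0
  show ?case by auto
next
  case (Suc t)
  let ?A = "layer_amplitude U L"
  show ?case
  proof (cases "i = i'")
    case False
    then show ?thesis by simp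
  next
    case True
    let ?f = "\<lambda>k m. (?A 1 i m * cnj (?A 1 i m)) * (?A 0 m k * cnj (?A 0 m k)) * of_real (circuit_prob U L t k j)"
    have "replica_moment U L (Suc t) i i' j j = (\<Sum>k<2 ^ (2 * L). \<Sum>k'<2 ^ (2 * L).
        if k = k' then \<Sum>m<2 ^ (2 * L). \<Sum>m'<2 ^ (2 * L). if m = m' then ?f k m else 0 else 0)"
      unfolding replica_moment.simps Suc.IH True
      by (intro sum.cong refl) (auto intro!: sum.cong simp del: sum.delta sum.delta')
    also have "\<dots> = (\<Sum>k<2 ^ (2 * L). \<Sum>m<2 ^ (2 * L). ?f k m)"
      by (simp add: sum.delta')
    finally show ?thesis
      using True by (simp add: layer_prob_def complex_norm_square[symmetric])
  qed
qed

lemma has_bochner_integral_circuit: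
  assumes "0 < L" "U \<in> carrier_mat 4 4" "i < 2 ^ (2 * L)" "i' < 2 ^ (2 * L)"
    and "j < 2 ^ (2 * L)" "j' < 2 ^ (2 * L)"
  shows "has_bochner_integral phase_measure
    (\<lambda>\<theta>. circuit U L \<theta> t $$ (i, j) * cnj (circuit U L \<theta> t $$ (i', j'))) (replica_moment U L t i i' j j')"
  using has_bochner_integral_circuit_pair[where F = "{}", OF assms(1,2,5,6) _ _ assms(3,4)] by simp

text \<open>The replicas in the squared trace may start in different states \<open>i\<close> and
  \<open>i'\<close>, and one step suffices to kill the terms with \<open>i \<noteq> i'\<close>. At
  \<open>t = 0\<close> no phase has acted and moments with \<open>i \<noteq> i'\<close> survive,
  hence the condition \<open>0 < t\<close>.\<close>

lemma spectral_form_factor_eq: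
  assumes "0 < L" "U \<in> carrier_mat 4 4" "0 < t"
  shows "spectral_form_factor U L t = (\<Sum>i<2 ^ (2 * L). circuit_prob U L t i i)"
proof -
  let ?N = "2 ^ (2 * L) :: nat"
  have trace: "mat_trace (circuit U L \<theta> t) = (\<Sum>i<?N. circuit U L \<theta> t $$ (i, i))" for \<theta>
    using circuit_carrier[of U L \<theta> t] by (simp add: mat_trace_def)
  have "has_bochner_integral phase_measure
      (\<lambda>\<theta>. \<Sum>i<?N. \<Sum>i'<?N. circuit U L \<theta> t $$ (i, i) * cnj (circuit U L \<theta> t $$ (i', i')))
      (\<Sum>i<?N. \<Sum>i'<?N. replica_moment U L t i i' i i')"
    using assms by (intro has_bochner_integral_sum has_bochner_integral_circuit) auto
  also have "(\<lambda>\<theta>. \<Sum>i<?N. \<Sum>i'<?N. circuit U L \<theta> t $$ (i, i) * cnj (circuit U L \<theta> t $$ (i', i')))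
      = (\<lambda>\<theta>. of_real ((cmod (mat_trace (circuit U L \<theta> t)))\<^sup>2))"
    unfolding complex_norm_square trace cnj_sum sum_product ..
  also have "(\<Sum>i<?N. \<Sum>i'<?N. replica_moment U L t i i' i i')
      = (\<Sum>i<?N. \<Sum>i'<?N. if i = i' then of_real (circuit_prob U L t i i) else 0)"
  proof (intro sum.cong refl)
    fix i i'
    show "replica_moment U L t i i' i i' = (if i = i' then of_real (circuit_prob U L t i i) else 0)"
      using assms(3) replica_moment_Suc_neq[of i i' U L "t - 1"]
      by (auto simp: replica_moment_same_column simp del: replica_moment.simps)
  qed
  also have "\<dots> = of_real (\<Sum>i<?N. circuit_prob U L t i i)"
    by (simp add: sum.delta')
  finally have "has_bochner_integral phase_measure
      (\<lambda>\<theta>. Re (of_real ((cmod (mat_trace (circuit U L \<theta> t)))\<^sup>2)))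
      (Re (of_real (\<Sum>i<?N. circuit_prob U L t i i)))"
    by (rule has_bochner_integral_bounded_linear[OF bounded_linear_Re])
  then show ?thesis
    unfolding spectral_form_factor_def by (simp add: has_bochner_integral_integral_eq)
qed

section \<open>Two-point functions in terms of transition probabilities\<close>

lemma mat_trace_diag_conjugation:
  assumes C: "C \<in> carrier_mat n n"
  shows "mat_trace (mat_diag n f * mat_adjoint C * mat_diag n h * C)
    = (\<Sum>k<n. \<Sum>i<n. f k * h i * of_real ((cmod (C $$ (i, k)))\<^sup>2))"
proof -
  have adj: "mat_adjoint C \<in> carrier_mat n n"
    using carrier_matD[OF C] by (intro carrier_matI) (simp_all add: mat_adjoint_def)
  have adj_entry: "mat_adjoint C $$ (k, i) = cnj (C $$ (i, k))" if "k < n" "i < n" for i k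
    using carrier_matD[OF C] that by (simp add: mat_adjoint_def mat_of_rows_def)
  have D: "mat_diag n f * mat_adjoint C \<in> carrier_mat n n"
    by (rule mult_carrier_mat[OF mat_diag_dim adj])
  have "(mat_diag n f * mat_adjoint C * mat_diag n h * C) $$ (k, k)
      = (\<Sum>i<n. f k * h i * of_real ((cmod (C $$ (i, k)))\<^sup>2))" if "k < n" for k
  proof -
    have "(mat_diag n f * mat_adjoint C * mat_diag n h) $$ (k, i) = f k * cnj (C $$ (i, k)) * h i"
      if "i < n" for i
      using that \<open>k < n\<close> C adj
      by (subst mat_diag_mult_right[OF D], simp, subst mat_diag_mult_left[OF adj]) (simp add: adj_entry)
    moreover have "(mat_diag n f * mat_adjoint C * mat_diag n h * C) $$ (k, k)
      = (\<Sum>i<n. (mat_diag n f * mat_adjoint C * mat_diag n h) $$ (k, i) * C $$ (i, k))"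
      using D C that by (intro mult_mat_entry) auto
    ultimately show ?thesis
      unfolding complex_norm_square by (simp add: mult_ac)
  qed
  moreover have "dim_row (mat_diag n f * mat_adjoint C * mat_diag n h * C) = n"
    by (simp add: mat_diag_def)
  ultimately show ?thesis by (simp add: mat_trace_def)
qed

text \<open>The operators \<open>sigma_z_at\<close> are diagonal, so both replicas share the initial
  and the final state; the formula therefore holds at \<open>t = 0\<close> as well.\<close>

lemma two_point_eq:
  assumes "0 < L" "U \<in> carrier_mat 4 4"
  shows "two_point U L x y t = (\<Sum>k<2 ^ (2 * L). \<Sum>i<2 ^ (2 * L).
    of_int (spin k x) * of_int (spin i y) * circuit_prob U L t i k) / 2 ^ (2 * L)"
proof -
  let ?N = "2 ^ (2 * L) :: nat" and ?C = "\<lambda>\<theta>. circuit U L \<theta> t"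
  have Z: "sigma_z_at L x = mat_diag ?N (\<lambda>i. of_int (spin i x))" for x
    unfolding sigma_z_at_def by (rule arg_cong[where f = "mat_diag ?N"]) (auto simp: spin_def)
  have "has_bochner_integral phase_measure
      (\<lambda>\<theta>. \<Sum>k<?N. \<Sum>i<?N. of_int (spin k x) * of_int (spin i y) * (?C \<theta> $$ (i, k) * cnj (?C \<theta> $$ (i, k))))
      (\<Sum>k<?N. \<Sum>i<?N. of_int (spin k x) * of_int (spin i y) * replica_moment U L t i i k k)"
    using assms
    by (intro has_bochner_integral_sum has_bochner_integral_mult_right has_bochner_integral_circuit) auto
  also have "(\<lambda>\<theta>. \<Sum>k<?N. \<Sum>i<?N. of_int (spin k x) * of_int (spin i y) * (?C \<theta> $$ (i, k) * cnj (?C \<theta> $$ (i, k))))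
      = (\<lambda>\<theta>. mat_trace (sigma_z_at L x * mat_adjoint (?C \<theta>) * sigma_z_at L y * ?C \<theta>))"
    unfolding Z mat_trace_diag_conjugation[OF circuit_carrier] complex_norm_square ..
  also have "(\<Sum>k<?N. \<Sum>i<?N. of_int (spin k x) * of_int (spin i y) * replica_moment U L t i i k k)
      = of_real (\<Sum>k<?N. \<Sum>i<?N. of_int (spin k x) * of_int (spin i y) * circuit_prob U L t i k)"
    by (simp add: replica_moment_same_column)
  finally have "has_bochner_integral phase_measure
      (\<lambda>\<theta>. Re (mat_trace (sigma_z_at L x * mat_adjoint (?C \<theta>) * sigma_z_at L y * ?C \<theta>)))
      (Re (of_real (\<Sum>k<?N. \<Sum>i<?N. of_int (spin k x) * of_int (spin i y) * circuit_prob U L t i k)))"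
    by (rule has_bochner_integral_bounded_linear[OF bounded_linear_Re])
  then have "has_bochner_integral phase_measure
      (\<lambda>\<theta>. Re (mat_trace (sigma_z_at L x * mat_adjoint (?C \<theta>) * sigma_z_at L y * ?C \<theta>)) / 2 ^ (2 * L))
      ((\<Sum>k<?N. \<Sum>i<?N. of_int (spin k x) * of_int (spin i y) * circuit_prob U L t i k) / 2 ^ (2 * L))"
    unfolding Re_complex_of_real by (rule has_bochner_integral_divide_zero)
  then show ?thesis
    unfolding two_point_def by (rule has_bochner_integral_integral_eq)
qed

subsection \<open>Convergence of traces of positive matrix powers\<close>

text \<open>The index set is a parameter so that restricting it gives the powers of a diagonal
  block.\<close>

primrec kernel_power :: "'a set \<Rightarrow> ('a \<Rightarrow> 'a \<Rightarrow> real) \<Rightarrow> nat \<Rightarrow> 'a \<Rightarrow> 'a \<Rightarrow> real" where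
  "kernel_power S q 0 x y = of_bool (x = y)"
| "kernel_power S q (Suc t) x y = (\<Sum>z\<in>S. kernel_power S q t x z * q z y)"

lemma kernel_power_add:
  assumes "finite S" "y \<in> S"
  shows "kernel_power S q (s + t) x y = (\<Sum>z\<in>S. kernel_power S q s x z * kernel_power S q t z y)"
  using assms(2)
proof (induction t arbitrary: y)
  case 0
  have "(\<Sum>z\<in>S. kernel_power S q s x z * kernel_power S q 0 z y)
      = (\<Sum>z\<in>S. if z = y then kernel_power S q s x y else 0)"
    by (intro sum.cong refl) auto
  then show ?case using 0 assms(1) by simp
next
  case (Suc t)
  have "kernel_power S q (s + Suc t) x y
      = (\<Sum>w\<in>S. \<Sum>z\<in>S. kernel_power S q s x z * kernel_power S q t z w * q w y)"
    by (simp add: Suc.IH sum_distrib_right)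
  also have "\<dots> = (\<Sum>z\<in>S. kernel_power S q s x z * kernel_power S q (Suc t) z y)"
    by (subst sum.swap) (simp add: sum_distrib_left mult.assoc)
  finally show ?case .
qed

text \<open>The level \<open>f\<close> cannot decrease along a path of nonzero entries, so a path
  between states of equal level never leaves that level.\<close>

lemma kernel_power_block:
  fixes f :: "'a \<Rightarrow> 'b::linorder"
  assumes "finite S" and tri: "\<And>x y. x \<in> S \<Longrightarrow> y \<in> S \<Longrightarrow> q x y \<noteq> 0 \<Longrightarrow> f x \<le> f y" and x: "x \<in> S"
  shows "y \<in> S \<Longrightarrow> f y = f x \<Longrightarrow> kernel_power S q t x y = kernel_power {z \<in> S. f z = f x} q t x y"
proof (induction t arbitrary: y)
  case 0
  show ?case by simp
next
  case (Suc t)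
  have tri_power: "f x \<le> f y" if "y \<in> S" "kernel_power S q t x y \<noteq> 0" for y t
    using that
  proof (induction t arbitrary: y)
    case (Suc t)
    then obtain z where "z \<in> S" "kernel_power S q t x z * q z y \<noteq> 0"
      by (auto elim: sum.not_neutral_contains_not_neutral)
    then show ?case using Suc tri[of z y] by fastforce
  qed (auto split: if_splits)
  have "kernel_power S q t x z * q z y = 0" if "z \<in> S" "f z \<noteq> f x" for z
    using tri_power[OF that(1), of t] tri[OF that(1) Suc.prems(1)] that(2) Suc.prems(2) by fastforce
  then have "kernel_power S q (Suc t) x y
      = (\<Sum>z\<in>{z \<in> S. f z = f x}. kernel_power S q t x z * q z y)"
    unfolding kernel_power.simps using assms(1) by (intro sum.mono_neutral_right) auto
  then show ?case using Suc.IH by simp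
qed

lemma kernel_power_nonneg:
  assumes "\<And>x y. x \<in> S \<Longrightarrow> y \<in> S \<Longrightarrow> 0 \<le> q x y" "x \<in> S"
  shows "y \<in> S \<Longrightarrow> 0 \<le> kernel_power S q t x y"
  by (induction t arbitrary: y) (auto intro!: sum_nonneg mult_nonneg_nonneg assms)

lemma power_diag_le_kernel_power:
  assumes "finite S" "x \<in> S" and nonneg: "\<And>x y. x \<in> S \<Longrightarrow> y \<in> S \<Longrightarrow> 0 \<le> q x y"
  shows "q x x ^ t \<le> kernel_power S q t x x"
proof (induction t)
  case (Suc t)
  have "q x x ^ t * q x x \<le> kernel_power S q t x x * q x x"
    using Suc nonneg[OF assms(2,2)] by (rule mult_right_mono)
  also have "\<dots> \<le> (\<Sum>z\<in>S. kernel_power S q t x z * q z x)"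
    using assms by (intro member_le_sum[where f = "\<lambda>z. kernel_power S q t x z * q z x"])
      (auto intro!: mult_nonneg_nonneg kernel_power_nonneg)
  finally show ?case by (simp add: mult.commute)
qed simp

lemma kernel_power_eigenvector:
  fixes \<mu> :: real
  assumes "finite S" "x \<in> S" and "\<And>x. x \<in> S \<Longrightarrow> (\<Sum>y\<in>S. q x y * v y) = \<mu> * v x"
  shows "(\<Sum>y\<in>S. kernel_power S q t x y * v y) = \<mu> ^ t * v x"
proof (induction t)
  case 0
  have "(\<Sum>y\<in>S. kernel_power S q 0 x y * v y) = (\<Sum>y\<in>S. if y = x then v x else 0)"
    by (intro sum.cong refl) auto
  then show ?case using assms(1,2) by simp
next
  case (Suc t)
  have "(\<Sum>y\<in>S. kernel_power S q (Suc t) x y * v y)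
      = (\<Sum>z\<in>S. kernel_power S q t x z * (\<Sum>y\<in>S. q z y * v y))"
    by (simp add: sum_distrib_right sum_distrib_left mult.assoc) (subst sum.swap, rule refl)
  also have "\<dots> = (\<Sum>z\<in>S. kernel_power S q t x z * (\<mu> * v z))"
    by (simp add: assms(3))
  also have "\<dots> = (\<Sum>z\<in>S. kernel_power S q t x z * v z) * \<mu>"
    unfolding sum_distrib_right by (intro sum.cong refl) (simp only: mult_ac)
  finally show ?case using Suc by (simp add: mult_ac)
qed

text \<open>Iterating the inequality gives \<open>\<mu> ^ t * v x\<close> as a bound for the
  weighted row sum, of which the diagonal term is one nonnegative summand.\<close>

lemma kernel_power_supersolution:
  fixes \<mu> :: real
  assumes "finite S" "x \<in> S" and nonneg: "\<And>x y. x \<in> S \<Longrightarrow> y \<in> S \<Longrightarrow> 0 \<le> q x y"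
    and "\<And>x. x \<in> S \<Longrightarrow> 0 < v x" "0 \<le> \<mu>"
    and super: "\<And>x. x \<in> S \<Longrightarrow> (\<Sum>y\<in>S. q x y * v y) \<le> \<mu> * v x"
  shows "kernel_power S q t x x \<le> \<mu> ^ t"
proof -
  have "(\<Sum>y\<in>S. kernel_power S q t x y * v y) \<le> \<mu> ^ t * v x"
  proof (induction t)
    case 0
    have "(\<Sum>y\<in>S. kernel_power S q 0 x y * v y) = (\<Sum>y\<in>S. if y = x then v x else 0)"
      by (intro sum.cong refl) auto
    then show ?case using assms(1,2) by simp
  next
    case (Suc t)
    have "(\<Sum>y\<in>S. kernel_power S q (Suc t) x y * v y)
        = (\<Sum>z\<in>S. kernel_power S q t x z * (\<Sum>y\<in>S. q z y * v y))"
      by (simp add: sum_distrib_right sum_distrib_left mult.assoc) (subst sum.swap, rule refl)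
    also have "\<dots> \<le> (\<Sum>z\<in>S. kernel_power S q t x z * (\<mu> * v z))"
      using assms(2) by (intro sum_mono mult_left_mono super kernel_power_nonneg nonneg) auto
    also have "\<dots> = \<mu> * (\<Sum>z\<in>S. kernel_power S q t x z * v z)"
      by (simp add: sum_distrib_left mult_ac)
    also have "\<dots> \<le> \<mu> * (\<mu> ^ t * v x)"
      using Suc assms(5) by (rule mult_left_mono)
    finally show ?case by (simp add: mult_ac)
  qed
  moreover have "kernel_power S q t x x * v x \<le> (\<Sum>y\<in>S. kernel_power S q t x y * v y)"
    using assms(1,2)
    by (intro member_le_sum[where f = "\<lambda>y. kernel_power S q t x y * v y"])
       (auto intro!: mult_nonneg_nonneg kernel_power_nonneg[OF nonneg] less_imp_le[OF assms(4)])
  ultimately have "kernel_power S q t x x * v x \<le> \<mu> ^ t * v x" by linarith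
  then show ?thesis using assms(4)[OF assms(2)] by simp
qed

text \<open>Doeblin's contraction: both weights contain the mass \<open>\<delta>\<close> at \<open>z\<close>, which cancels.\<close>

lemma weighted_sum_diff_le:
  fixes \<alpha> \<beta> f :: "'a \<Rightarrow> real"
  assumes S: "finite S" "z \<in> S" and \<delta>: "0 \<le> \<delta>"
    and \<alpha>: "\<And>x. x \<in> S \<Longrightarrow> 0 \<le> \<alpha> x" "(\<Sum>x\<in>S. \<alpha> x) = 1" "\<delta> \<le> \<alpha> z"
    and \<beta>: "\<And>x. x \<in> S \<Longrightarrow> 0 \<le> \<beta> x" "(\<Sum>x\<in>S. \<beta> x) = 1" "\<delta> \<le> \<beta> z"
    and f: "\<And>x y. x \<in> S \<Longrightarrow> y \<in> S \<Longrightarrow> f x - f y \<le> c"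
  shows "(\<Sum>x\<in>S. \<alpha> x * f x) - (\<Sum>x\<in>S. \<beta> x * f x) \<le> (1 - \<delta>) * c"
proof -
  let ?M = "Max (f ` S)" and ?m = "Min (f ` S)"
  have split: "(\<Sum>x\<in>S. \<gamma> x * h x) = (\<Sum>x\<in>S. (\<gamma> x - (if x = z then \<delta> else 0)) * h x) + \<delta> * h z"
    for \<gamma> h :: "'a \<Rightarrow> real"
  proof -
    have "(\<Sum>x\<in>S. \<gamma> x * h x)
        = (\<Sum>x\<in>S. (\<gamma> x - (if x = z then \<delta> else 0)) * h x + (if x = z then \<delta> * h z else 0))"
      by (intro sum.cong refl) (simp add: algebra_simps)
    then show ?thesis using S by (simp add: sum.distrib)
  qed
  have mass: "(\<Sum>x\<in>S. \<gamma> x - (if x = z then \<delta> else 0)) = 1 - \<delta>" if "(\<Sum>x\<in>S. \<gamma> x) = 1" for \<gamma>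
    using split[of \<gamma> "\<lambda>_. 1"] that by simp
  have "(\<Sum>x\<in>S. (\<alpha> x - (if x = z then \<delta> else 0)) * f x)
      \<le> (\<Sum>x\<in>S. (\<alpha> x - (if x = z then \<delta> else 0)) * ?M)"
    using S \<alpha> by (intro sum_mono mult_left_mono) auto
  also have "\<dots> = (1 - \<delta>) * ?M"
    using mass[OF \<alpha>(2)] by (simp add: sum_distrib_right[symmetric])
  finally have upper: "(\<Sum>x\<in>S. (\<alpha> x - (if x = z then \<delta> else 0)) * f x) \<le> (1 - \<delta>) * ?M" .
  have "(1 - \<delta>) * ?m = (\<Sum>x\<in>S. (\<beta> x - (if x = z then \<delta> else 0)) * ?m)"
    using mass[OF \<beta>(2)] by (simp add: sum_distrib_right[symmetric])
  also have "\<dots> \<le> (\<Sum>x\<in>S. (\<beta> x - (if x = z then \<delta> else 0)) * f x)"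
    using S \<beta> by (intro sum_mono mult_left_mono) auto
  finally have lower: "(1 - \<delta>) * ?m \<le> (\<Sum>x\<in>S. (\<beta> x - (if x = z then \<delta> else 0)) * f x)" .
  have "?M \<in> f ` S" "?m \<in> f ` S" using S by (auto intro!: Max_in Min_in)
  then have "?M - ?m \<le> c" using f by auto
  moreover have "\<alpha> z \<le> (\<Sum>x\<in>S. \<alpha> x)"
    using S \<alpha>(1) by (intro member_le_sum) auto
  then have "\<delta> \<le> 1" using \<alpha>(2,3) by linarith
  ultimately have "(1 - \<delta>) * (?M - ?m) \<le> (1 - \<delta>) * c" by (intro mult_left_mono) auto
  then show ?thesis
    unfolding split[of \<alpha> f] split[of \<beta> f] using upper lower by (simp add: right_diff_distrib)
qed

text \<open>The function \<open>rank\<close> certifies that \<open>z\<close> is reachable from every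
  state, and the loop at \<open>z\<close> pads the paths to a common length \<open>m\<close>. Column
  \<open>z\<close> of the \<open>m\<close>-th power is then bounded below, so all rows merge
  exponentially fast; replacing each diagonal entry by the entry of row \<open>z\<close> in its
  column turns the trace into a row sum, which is 1.\<close>

lemma stochastic_trace_tendsto:
  fixes p :: "'a \<Rightarrow> 'a \<Rightarrow> real" and rank :: "'a \<Rightarrow> nat"
  assumes S: "finite S" "z \<in> S" and nonneg: "\<And>x y. x \<in> S \<Longrightarrow> y \<in> S \<Longrightarrow> 0 \<le> p x y"
    and row: "\<And>x. x \<in> S \<Longrightarrow> (\<Sum>y\<in>S. p x y) = 1"
    and loop: "0 < p z z"
    and descent: "\<And>x. x \<in> S \<Longrightarrow> x \<noteq> z \<Longrightarrow> \<exists>y\<in>S. rank y < rank x \<and> 0 < p x y"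
  shows "(\<lambda>t. \<Sum>x\<in>S. kernel_power S p t x x) \<longlonglongrightarrow> 1"
proof -
  let ?p = "kernel_power S p"
  have pos: "0 \<le> ?p t x y" if "x \<in> S" "y \<in> S" for t x y
    using nonneg that by (intro kernel_power_nonneg)
  have rows: "(\<Sum>y\<in>S. ?p t x y) = 1" if "x \<in> S" for t x
    using kernel_power_eigenvector[of S x p "\<lambda>_. 1" 1 t] S(1) that row by simp
  have one: "?p (Suc 0) x y = p x y" if "x \<in> S" for x y
  proof -
    have "?p (Suc 0) x y = (\<Sum>w\<in>S. if w = x then p x y else 0)"
      unfolding kernel_power.simps by (intro sum.cong refl) auto
    then show ?thesis using S(1) that by simp
  qed
  have step: "p x y * ?p k y w \<le> ?p (Suc k) x w" if "x \<in> S" "y \<in> S" "w \<in> S" for x y w k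
  proof -
    have "?p (1 + k) x w = (\<Sum>y\<in>S. p x y * ?p k y w)"
      unfolding kernel_power_add[OF S(1) that(3)] using that by (simp add: one del: kernel_power.simps)
    moreover have "p x y * ?p k y w \<le> (\<Sum>y\<in>S. p x y * ?p k y w)"
      using that by (intro member_le_sum S) (auto intro!: mult_nonneg_nonneg nonneg pos)
    ultimately show ?thesis by simp
  qed
  have reach: "0 < ?p k x z" if "x \<in> S" "rank x \<le> k" for x k
    using that
  proof (induction k arbitrary: x)
    case 0
    then have "x = z" using descent[of x] by auto
    then show ?case by simp
  next
    case (Suc k)
    consider "x = z" "rank x \<le> k" | "x = z" "rank x = Suc k"
      | y where "y \<in> S" "rank y < rank x" "0 < p x y"
      using descent[of x] Suc.prems by (cases "x = z") (auto simp: le_Suc_eq)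
    then show ?case
    proof cases
      case 1
      then have "0 < p z z * ?p k z z" using Suc loop by simp
      then show ?thesis using step[OF S(2) S(2) S(2), of k] 1 by simp
    next
      case 2
      have "0 < ?p n z z" for n
      proof (induction n)
        case (Suc n)
        then have "0 < p z z * ?p n z z" using loop by simp
        then show ?case using step[OF S(2) S(2) S(2), of n] by linarith
      qed simp
      then show ?thesis using 2 by blast
    next
      case 3
      then have "0 < p x y * ?p k y z" using Suc by simp
      then show ?thesis using step[OF Suc.prems(1) 3(1) S(2), of k] by linarith
    qed
  qed
  \<comment> \<open>\<open>Suc\<close> keeps \<open>m\<close> positive, so that
    \<open>t div m\<close> tends to infinity.\<close>
  define m where "m = Suc (Max (rank ` S))"
  define \<delta> where "\<delta> = Min ((\<lambda>x. ?p m x z) ` S)"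
  have "rank x \<le> m" if "x \<in> S" for x
    using S(1) that by (auto simp: m_def intro: le_SucI)
  then have "0 < \<delta>" unfolding \<delta>_def using S by (subst Min_gr_iff) (auto intro: reach)
  have \<delta>_le: "\<delta> \<le> ?p m x z" if "x \<in> S" for x
    unfolding \<delta>_def using S(1) that by (intro Min_le) auto
  have le_1: "?p t x y \<le> 1" if "x \<in> S" "y \<in> S" for t x y
    using member_le_sum[OF that(2) _ S(1), of "?p t x"] pos that rows[OF that(1), of t] by auto
  have "\<delta> \<le> 1" using \<delta>_le[OF S(2)] le_1[OF S(2) S(2), of m] by linarith
  have osc: "?p (k * m + r) x y - ?p (k * m + r) x' y \<le> (1 - \<delta>) ^ k"
    if "x \<in> S" "x' \<in> S" "y \<in> S" for k r x x' y
    using that(1,2)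
  proof (induction k arbitrary: x x')
    case 0
    show ?case using le_1[OF 0(1) that(3), of r] pos[OF 0(2) that(3), of r] by simp
  next
    case (Suc k)
    have "?p (Suc k * m + r) x y = (\<Sum>w\<in>S. ?p m x w * ?p (k * m + r) w y)" for x
      using kernel_power_add[OF S(1) that(3), of p m "k * m + r" x] by (simp add: add.assoc)
    moreover have "(\<Sum>w\<in>S. ?p m x w * ?p (k * m + r) w y) - (\<Sum>w\<in>S. ?p m x' w * ?p (k * m + r) w y)
        \<le> (1 - \<delta>) * (1 - \<delta>) ^ k"
      using Suc \<open>0 < \<delta>\<close> by (intro weighted_sum_diff_le[OF S]) (auto intro: pos rows \<delta>_le)
    ultimately show ?case by simp
  qed
  have bound: "\<bar>(\<Sum>y\<in>S. ?p t y y) - 1\<bar> \<le> card S * (1 - \<delta>) ^ (t div m)" for t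
  proof -
    have osc': "?p t x y - ?p t x' y \<le> (1 - \<delta>) ^ (t div m)" if "x \<in> S" "x' \<in> S" "y \<in> S" for x x' y
      using osc[OF that, of "t div m" "t mod m"] by simp
    have "(\<Sum>y\<in>S. ?p t y y) - 1 = (\<Sum>y\<in>S. ?p t y y - ?p t z y)"
      using rows[OF S(2), of t] by (simp add: sum_subtractf)
    also have "\<bar>\<dots>\<bar> \<le> (\<Sum>y\<in>S. \<bar>?p t y y - ?p t z y\<bar>)" by (rule sum_abs)
    also have "\<dots> \<le> (\<Sum>y\<in>S. (1 - \<delta>) ^ (t div m))"
      using osc' S(2) by (intro sum_mono) (simp add: abs_le_iff)
    finally show ?thesis by simp
  qed
  have "(\<lambda>t. card S * (1 - \<delta>) ^ (t div m)) \<longlonglongrightarrow> 0"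
  proof -
    have "filterlim (\<lambda>t. t div m) at_top sequentially"
      unfolding filterlim_at_top
    proof
      fix Z
      have "\<forall>\<^sub>F t in sequentially. Z * m \<le> t" by (rule eventually_ge_at_top)
      then show "\<forall>\<^sub>F t in sequentially. Z \<le> t div m"
        by eventually_elim (simp add: m_def less_eq_div_iff_mult_less_eq)
    qed
    then have "(\<lambda>t. (1 - \<delta>) ^ (t div m)) \<longlonglongrightarrow> 0"
      using \<open>0 < \<delta>\<close> \<open>\<delta> \<le> 1\<close> by (intro filterlim_compose[OF LIMSEQ_realpow_zero]) auto
    then show ?thesis by (rule tendsto_mult_right_zero)
  qed
  then have "(\<lambda>t. (\<Sum>y\<in>S. ?p t y y) - 1) \<longlonglongrightarrow> 0"
    by (rule Lim_null_comparison[rotated]) (use bound in simp)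
  then show ?thesis by (rule LIM_zero_cancel)
qed

text \<open>Conjugation by the positive eigenvector and division by the eigenvalue turn the kernel
  into a stochastic one.\<close>

lemma trace_kernel_power_asymp:
  fixes q :: "'a \<Rightarrow> 'a \<Rightarrow> real" and rank :: "'a \<Rightarrow> nat"
  assumes S: "finite S" "z \<in> S" and nonneg: "\<And>x y. x \<in> S \<Longrightarrow> y \<in> S \<Longrightarrow> 0 \<le> q x y"
    and v: "\<And>x. x \<in> S \<Longrightarrow> 0 < v x" and "0 < \<mu>"
    and eigen: "\<And>x. x \<in> S \<Longrightarrow> (\<Sum>y\<in>S. q x y * v y) = \<mu> * v x"
    and loop: "0 < q z z"
    and descent: "\<And>x. x \<in> S \<Longrightarrow> x \<noteq> z \<Longrightarrow> \<exists>y\<in>S. rank y < rank x \<and> 0 < q x y"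
  shows "(\<lambda>t. (\<Sum>x\<in>S. kernel_power S q t x x) / \<mu> ^ t) \<longlonglongrightarrow> 1"
proof -
  define p where "p x y = q x y * v y / (\<mu> * v x)" for x y
  have power: "kernel_power S p t x y = kernel_power S q t x y * v y / (\<mu> ^ t * v x)"
    if "x \<in> S" "y \<in> S" for t x y
    using that(2)
  proof (induction t arbitrary: y)
    case 0
    then show ?case using v[of x] that(1) by auto
  next
    case (Suc t)
    have "kernel_power S p (Suc t) x y
        = (\<Sum>w\<in>S. (kernel_power S q t x w * v w / (\<mu> ^ t * v x)) * (q w y * v y / (\<mu> * v w)))"
      unfolding kernel_power.simps by (intro sum.cong refl) (simp only: Suc.IH p_def)
    \<comment> \<open>The weight of the intermediate state \<open>w\<close> cancels.\<close>
    also have "\<dots> = (\<Sum>w\<in>S. kernel_power S q t x w * q w y * v y / (\<mu> ^ Suc t * v x))"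
    proof (intro sum.cong refl)
      fix w assume "w \<in> S"
      then have "v w \<noteq> 0" "v x \<noteq> 0" "\<mu> \<noteq> 0" using v[of w] v[of x] that(1) \<open>0 < \<mu>\<close> by auto
      then show "(kernel_power S q t x w * v w / (\<mu> ^ t * v x)) * (q w y * v y / (\<mu> * v w))
          = kernel_power S q t x w * q w y * v y / (\<mu> ^ Suc t * v x)"
        by (simp add: field_simps)
    qed
    finally show ?case by (simp add: sum_distrib_right sum_divide_distrib)
  qed
  have "(\<lambda>t. \<Sum>x\<in>S. kernel_power S p t x x) \<longlonglongrightarrow> 1"
  proof (rule stochastic_trace_tendsto[OF S, where rank = rank])
    show "0 \<le> p x y" if "x \<in> S" "y \<in> S" for x y
      using nonneg[OF that] v[OF that(1)] v[OF that(2)] \<open>0 < \<mu>\<close> by (simp add: p_def)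
    show "(\<Sum>y\<in>S. p x y) = 1" if "x \<in> S" for x
      using eigen[OF that] v[OF that] \<open>0 < \<mu>\<close> by (simp add: p_def sum_divide_distrib[symmetric])
    show "0 < p z z" using loop v[OF S(2)] \<open>0 < \<mu>\<close> by (simp add: p_def)
    show "\<exists>y\<in>S. rank y < rank x \<and> 0 < p x y" if "x \<in> S" "x \<noteq> z" for x
      using descent[OF that] v that(1) \<open>0 < \<mu>\<close> by (fastforce simp: p_def)
  qed
  moreover have "(\<Sum>x\<in>S. kernel_power S p t x x) = (\<Sum>x\<in>S. kernel_power S q t x x) / \<mu> ^ t" for t
    unfolding sum_divide_distrib
  proof (intro sum.cong refl)
    fix x assume "x \<in> S"
    then show "kernel_power S p t x x = kernel_power S q t x x / \<mu> ^ t"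
      using v[of x] by (simp add: power)
  qed
  ultimately show ?thesis by simp
qed

subsection \<open>The averaged evolution in the basis of Pauli strings\<close>

definition pair_sign :: "nat \<Rightarrow> nat \<Rightarrow> real" where
  "pair_sign r k = (if 2 \<le> r \<and> 2 \<le> k then - 1 else 1) * (if odd r \<and> odd k then - 1 else 1)"

text \<open>The diagonal entry at basis state \<open>i\<close> of the string with a Pauli matrix at
  the sites given by the bits of \<open>A\<close>.\<close>

definition walsh :: "nat \<Rightarrow> nat \<Rightarrow> nat \<Rightarrow> real" where
  "walsh L A i = (\<Prod>j<2 * L. if bit A j \<and> bit i j then - 1 else 1)"

definition layer_transfer :: "nat \<Rightarrow> (nat \<Rightarrow> nat \<Rightarrow> real) \<Rightarrow> nat \<Rightarrow> nat \<Rightarrow> nat \<Rightarrow> real" where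
  "layer_transfer L w l A B = (\<Prod>x<L. w (pair_state L l x A) (pair_state L l x B))"

text \<open>Rows belong to the string at the initial time, so layer 0, which acts first, stands on
  the left.\<close>

definition step_transfer :: "nat \<Rightarrow> (nat \<Rightarrow> nat \<Rightarrow> real) \<Rightarrow> nat \<Rightarrow> nat \<Rightarrow> real" where
  "step_transfer L w A B = (\<Sum>D<2 ^ (2 * L). layer_transfer L w 0 A D * layer_transfer L w 1 D B)"

text \<open>The matrix \<open>M\<close> in the basis of Pauli strings, transposed: \<open>A\<close>
  is paired with the ingoing index \<open>k\<close> and \<open>B\<close> with the outgoing index
  \<open>i\<close>, as in the averaged gate.\<close>

definition walsh_coeff :: "nat \<Rightarrow> (nat \<Rightarrow> nat \<Rightarrow> real) \<Rightarrow> nat \<Rightarrow> nat \<Rightarrow> real" where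
  "walsh_coeff L M A B
    = (\<Sum>k<2 ^ (2 * L). \<Sum>i<2 ^ (2 * L). walsh L A k * walsh L B i * M i k) / 2 ^ (2 * L)"

lemma sum_lessThan_4: "(\<Sum>i<4::nat. f i) = f 0 + f 1 + f 2 + f 3"
  by (simp add: eval_nat_numeral)

lemma averaged_gate_entry:
  assumes "U \<in> carrier_mat 4 4" "r < 4" "s < 4"
  shows "averaged_gate U $$ (r, s)
    = (\<Sum>k<4. \<Sum>i<4. pair_sign r k * pair_sign s i * (cmod (U $$ (i, k)))\<^sup>2) / 4"
proof -
  have Z: "z_string r = mat_diag 4 (\<lambda>k. of_real (pair_sign r k))" if "r < 4" for r
  proof (rule eq_matI)
    fix i k :: nat assume "i < dim_row (mat_diag 4 (\<lambda>k. complex_of_real (pair_sign r k)))"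
      "k < dim_col (mat_diag 4 (\<lambda>k. complex_of_real (pair_sign r k)))"
    then have *: "i < 4" "k < 4" by (simp_all add: mat_diag_def)
    have sites: "(if c = 0 then 1\<^sub>m 2 else sigma_z) $$ (u, v)
        = (if u = v then of_real (if c \<noteq> 0 \<and> u \<noteq> 0 then - 1 else 1) else 0)"
      if "u < 2" "v < 2" for c u v :: nat
      using that by (simp add: sigma_z_def mat_diag_def)
    show "z_string r $$ (i, k) = mat_diag 4 (\<lambda>k. of_real (pair_sign r k)) $$ (i, k)"
    proof (cases "i = k")
      case True
      then show ?thesis using * that
        by (auto simp: z_string_def Let_def tensor2_def sites mat_diag_def pair_sign_def odd_iff_mod_2_eq_one)
    next
      case False
      then have "i div 2 \<noteq> k div 2 \<or> i mod 2 \<noteq> k mod 2" by (metis div_mult_mod_eq)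
      then show ?thesis using * that False
        by (auto simp: z_string_def Let_def tensor2_def sites mat_diag_def)
    qed
  qed (simp_all add: z_string_def Let_def tensor2_def mat_diag_def)
  have "averaged_gate U $$ (r, s) = Re (mat_trace (z_string r * mat_adjoint U * z_string s * U)) / 4"
    using assms by (simp add: averaged_gate_def)
  also have "mat_trace (z_string r * mat_adjoint U * z_string s * U)
      = of_real (\<Sum>k<4. \<Sum>i<4. pair_sign r k * pair_sign s i * (cmod (U $$ (i, k)))\<^sup>2)"
    unfolding Z[OF assms(2)] Z[OF assms(3)] mat_trace_diag_conjugation[OF assms(1)] by simp
  finally show ?thesis by simp
qed

lemma walsh_eq_prod_pairs:
  assumes "0 < L"
  shows "walsh L A i = (\<Prod>x<L. pair_sign (pair_state L l x A) (pair_state L l x i))"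
  unfolding walsh_def prod_over_pairs[OF assms, where l = l]
  by (intro prod.cong refl) (simp add: pair_sign_def bit_left_site[where L = L] bit_right_site)

lemma walsh_commute: "walsh L A i = walsh L i A"
  unfolding walsh_def by (intro prod.cong refl) auto

section \<open>Walsh transform of layers, products and traces\<close>

lemma pair_sign_orthogonal:
  assumes "r < 4" "s < 4"
  shows "(\<Sum>k<4. pair_sign r k * pair_sign s k) = 4 * of_bool (r = s)"
proof -
  have "r \<in> {0, 1, 2, 3}" "s \<in> {0, 1, 2, 3}" using assms by auto
  then show ?thesis by (auto simp: sum_lessThan_4 pair_sign_def)
qed

lemma walsh_orthogonal:
  assumes "0 < L" "A < 2 ^ (2 * L)" "B < 2 ^ (2 * L)"
  shows "(\<Sum>i<2 ^ (2 * L). walsh L A i * walsh L B i) = 2 ^ (2 * L) * of_bool (A = B)"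
proof -
  let ?p = "pair_state L 0"
  have "(\<Sum>i<2 ^ (2 * L). walsh L A i * walsh L B i)
      = (\<Sum>i<2 ^ (2 * L). \<Prod>x<L. pair_sign (?p x A) (?p x i) * pair_sign (?p x B) (?p x i))"
    by (simp add: walsh_eq_prod_pairs[OF assms(1), of _ _ 0] prod.distrib)
  also have "\<dots> = (\<Prod>x<L. \<Sum>k<4. pair_sign (?p x A) k * pair_sign (?p x B) k)"
    by (rule sum_prod_pair_states[OF assms(1)])
  also have "\<dots> = (\<Prod>x<L. 4 * of_bool (?p x A = ?p x B))"
    by (simp only: pair_sign_orthogonal pair_state_lt)
  also have "\<dots> = 4 ^ L * of_bool (\<forall>x<L. ?p x A = ?p x B)"
    by (auto simp: prod.distrib)
  also have "(\<forall>x<L. ?p x A = ?p x B) \<longleftrightarrow> A = B"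
    using eq_if_pair_states_eq[OF assms, of 0] by auto
  finally show ?thesis by (simp add: power_mult)
qed

lemma walsh_orthogonal':
  assumes "0 < L" "i < 2 ^ (2 * L)" "k < 2 ^ (2 * L)"
  shows "(\<Sum>A<2 ^ (2 * L). walsh L A i * walsh L A k) = 2 ^ (2 * L) * of_bool (i = k)"
  using walsh_orthogonal[OF assms] by (simp add: walsh_commute)

text \<open>Both the transition probabilities and the characters are products over the pairs, so the
  double sum factorises into one averaged gate per pair; the factors 4 absorb the
  normalisation.\<close>

lemma walsh_coeff_layer_prob:
  assumes "0 < L" "U \<in> carrier_mat 4 4"
  shows "walsh_coeff L (layer_prob U L l) A B = layer_transfer L (\<lambda>r s. averaged_gate U $$ (r, s)) l A B"
proof -
  let ?p = "pair_state L l" and ?u = "\<lambda>i k. (cmod (U $$ (i, k)))\<^sup>2"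
  note walsh = walsh_eq_prod_pairs[OF assms(1), of _ _ l]
  have prob: "layer_prob U L l i k = (\<Prod>x<L. ?u (?p x i) (?p x k))" for i k
    by (simp add: layer_prob_def layer_amplitude_def prod_norm[symmetric] prod_power_distrib)
  have gate: "4 * averaged_gate U $$ (r, s) = (\<Sum>k<4. \<Sum>i<4. pair_sign r k * pair_sign s i * ?u i k)"
    if "r < 4" "s < 4" for r s
    using averaged_gate_entry[OF assms(2) that] by simp
  have "(\<Sum>i<2 ^ (2 * L). walsh L B i * layer_prob U L l i k)
      = (\<Prod>x<L. \<Sum>i<4. pair_sign (?p x B) i * ?u i (?p x k))" for k
    unfolding sum_prod_pair_states[OF assms(1), symmetric, of _ l] walsh prob prod.distrib ..
  then have "(\<Sum>k<2 ^ (2 * L). \<Sum>i<2 ^ (2 * L). walsh L A k * walsh L B i * layer_prob U L l i k)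
      = (\<Sum>k<2 ^ (2 * L). \<Prod>x<L. pair_sign (?p x A) (?p x k)
          * (\<Sum>i<4. pair_sign (?p x B) i * ?u i (?p x k)))"
    by (simp add: mult.assoc sum_distrib_left[symmetric] walsh prod.distrib)
  also have "\<dots> = (\<Prod>x<L. \<Sum>k<4. pair_sign (?p x A) k * (\<Sum>i<4. pair_sign (?p x B) i * ?u i k))"
    by (rule sum_prod_pair_states[OF assms(1)])
  also have "\<dots> = (\<Prod>x<L. 4 * averaged_gate U $$ (?p x A, ?p x B))"
    by (simp add: gate pair_state_lt sum_distrib_left mult.assoc)
  also have "\<dots> = 2 ^ (2 * L) * layer_transfer L (\<lambda>r s. averaged_gate U $$ (r, s)) l A B"
    by (simp add: prod.distrib layer_transfer_def power_mult)
  finally show ?thesis by (simp add: walsh_coeff_def)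
qed

text \<open>Completeness of the characters at the intermediate state \<open>m\<close> glues the two
  coefficients. The order of \<open>M\<close> and \<open>M'\<close> is reversed because of the
  transposition in \<open>walsh_coeff\<close>.\<close>

lemma walsh_coeff_mult:
  assumes "0 < L"
  shows "walsh_coeff L (\<lambda>i k. \<Sum>m<2 ^ (2 * L). M i m * M' m k) A B
    = (\<Sum>C<2 ^ (2 * L). walsh_coeff L M' A C * walsh_coeff L M C B)"
proof -
  let ?N = "2 ^ (2 * L) :: nat" and ?W = "walsh L"
  \<comment> \<open>Multiplying by the squared normalisation clears both denominators; orthogonality
    returns one factor.\<close>
  have "(\<Sum>C<?N. walsh_coeff L M' A C * walsh_coeff L M C B) * (2 ^ (2 * L))\<^sup>2
      = (\<Sum>C<?N. (\<Sum>k<?N. \<Sum>m<?N. ?W A k * ?W C m * M' m k) * (\<Sum>m'<?N. \<Sum>i<?N. ?W C m' * ?W B i * M i m'))"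
    by (subst sum_distrib_right, rule sum.cong[OF refl]) (simp add: walsh_coeff_def power2_eq_square)
  also have "\<dots> = (\<Sum>C<?N. \<Sum>m<?N. \<Sum>m'<?N. (?W C m * ?W C m')
      * ((\<Sum>k<?N. ?W A k * M' m k) * (\<Sum>i<?N. ?W B i * M i m')))"
  proof (intro sum.cong refl)
    fix C
    have 1: "(\<Sum>k<?N. \<Sum>m<?N. ?W A k * ?W C m * M' m k) = (\<Sum>m<?N. ?W C m * (\<Sum>k<?N. ?W A k * M' m k))"
      by (subst sum.swap) (simp add: sum_distrib_left mult_ac)
    have 2: "(\<Sum>m'<?N. \<Sum>i<?N. ?W C m' * ?W B i * M i m') = (\<Sum>m'<?N. ?W C m' * (\<Sum>i<?N. ?W B i * M i m'))"
      by (simp add: sum_distrib_left mult_ac)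
    show "(\<Sum>k<?N. \<Sum>m<?N. ?W A k * ?W C m * M' m k) * (\<Sum>m'<?N. \<Sum>i<?N. ?W C m' * ?W B i * M i m')
      = (\<Sum>m<?N. \<Sum>m'<?N. (?W C m * ?W C m') * ((\<Sum>k<?N. ?W A k * M' m k) * (\<Sum>i<?N. ?W B i * M i m')))"
      unfolding 1 2 by (subst sum_product, intro sum.cong refl) (simp only: mult_ac)
  qed
  also have "\<dots> = (\<Sum>m<?N. \<Sum>m'<?N. (\<Sum>C<?N. ?W C m * ?W C m')
      * ((\<Sum>k<?N. ?W A k * M' m k) * (\<Sum>i<?N. ?W B i * M i m')))"
    unfolding sum_distrib_right
    by (subst sum.swap, rule sum.cong[OF refl], rule sum.swap)
  also have "\<dots> = (\<Sum>m<?N. \<Sum>m'<?N. if m = m' then 2 ^ (2 * L)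
      * ((\<Sum>k<?N. ?W A k * M' m k) * (\<Sum>i<?N. ?W B i * M i m)) else 0)"
    by (intro sum.cong refl) (auto simp: walsh_orthogonal'[OF assms])
  also have "\<dots> = 2 ^ (2 * L) * (\<Sum>m<?N. (\<Sum>k<?N. ?W A k * M' m k) * (\<Sum>i<?N. ?W B i * M i m))"
    by (simp add: sum_distrib_left)
  also have "(\<Sum>m<?N. (\<Sum>k<?N. ?W A k * M' m k) * (\<Sum>i<?N. ?W B i * M i m))
      = (\<Sum>k<?N. \<Sum>i<?N. ?W A k * ?W B i * (\<Sum>m<?N. M i m * M' m k))"
  proof -
    have "(\<Sum>m<?N. (\<Sum>k<?N. ?W A k * M' m k) * (\<Sum>i<?N. ?W B i * M i m))
        = (\<Sum>m<?N. \<Sum>k<?N. \<Sum>i<?N. (?W A k * M' m k) * (?W B i * M i m))"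
      by (simp only: sum_product)
    also have "\<dots> = (\<Sum>k<?N. \<Sum>i<?N. \<Sum>m<?N. (?W A k * M' m k) * (?W B i * M i m))"
      by (subst sum.swap, rule sum.cong[OF refl], rule sum.swap)
    also have "\<dots> = (\<Sum>k<?N. \<Sum>i<?N. ?W A k * ?W B i * (\<Sum>m<?N. M i m * M' m k))"
      unfolding sum_distrib_left by (intro sum.cong refl) (simp only: mult_ac)
    finally show ?thesis .
  qed
  finally show ?thesis
    by (simp add: walsh_coeff_def power2_eq_square field_simps)
qed

lemma walsh_coeff_of_bool:
  assumes "0 < L" "A < 2 ^ (2 * L)" "B < 2 ^ (2 * L)"
  shows "walsh_coeff L (\<lambda>i k. of_bool (i = k)) A B = of_bool (A = B)"
proof -
  have "(\<Sum>k<2 ^ (2 * L). \<Sum>i<2 ^ (2 * L). walsh L A k * walsh L B i * of_bool (i = k))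
      = (\<Sum>k<2 ^ (2 * L). \<Sum>i<2 ^ (2 * L). if i = k then walsh L A k * walsh L B k else 0)"
    by (intro sum.cong refl) auto
  also have "\<dots> = (\<Sum>k<2 ^ (2 * L). walsh L A k * walsh L B k)" by simp
  finally show ?thesis by (simp add: walsh_coeff_def walsh_orthogonal[OF assms])
qed

lemma walsh_coeff_circuit_prob:
  assumes "0 < L" "U \<in> carrier_mat 4 4" "A < 2 ^ (2 * L)"
  shows "B < 2 ^ (2 * L) \<Longrightarrow>
    walsh_coeff L (circuit_prob U L t) A B = kernel_power {..<2 ^ (2 * L)} (step_transfer L (\<lambda>r s. averaged_gate U $$ (r, s))) t A B"
proof (induction t arbitrary: B)
  case 0
  then show ?case using walsh_coeff_of_bool[OF assms(1,3)] by simp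
next
  case (Suc t)
  let ?P = "\<lambda>i k. \<Sum>m<2 ^ (2 * L). layer_prob U L 1 i m * layer_prob U L 0 m k"
  have "circuit_prob U L (Suc t) = (\<lambda>i j. \<Sum>k<2 ^ (2 * L). ?P i k * circuit_prob U L t k j)"
    by (simp add: fun_eq_iff sum_distrib_right)
  then show ?case
    using Suc.IH
    by (simp add: walsh_coeff_mult[OF assms(1)] walsh_coeff_layer_prob[OF assms(1,2)] step_transfer_def)
qed

text \<open>The trace does not depend on the basis; concretely, summing the characters over
  \<open>A\<close> leaves only \<open>i = k\<close>.\<close>

lemma spectral_form_factor_eq_trace:
  assumes "0 < L" "U \<in> carrier_mat 4 4" "0 < t"
  shows "spectral_form_factor U L t
    = (\<Sum>A<2 ^ (2 * L). kernel_power {..<2 ^ (2 * L)} (step_transfer L (\<lambda>r s. averaged_gate U $$ (r, s))) t A A)"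
proof -
  let ?N = "2 ^ (2 * L) :: nat" and ?P = "circuit_prob U L t"
  have "(\<Sum>A<?N. walsh_coeff L ?P A A) * 2 ^ (2 * L)
      = (\<Sum>A<?N. \<Sum>k<?N. \<Sum>i<?N. (walsh L A k * walsh L A i) * ?P i k)"
    unfolding sum_distrib_right by (simp add: walsh_coeff_def)
  also have "\<dots> = (\<Sum>k<?N. \<Sum>i<?N. (\<Sum>A<?N. walsh L A k * walsh L A i) * ?P i k)"
    unfolding sum_distrib_right
    by (subst sum.swap, rule sum.cong[OF refl], rule sum.swap)
  also have "\<dots> = (\<Sum>k<?N. \<Sum>i<?N. if k = i then 2 ^ (2 * L) * ?P k k else 0)"
    by (intro sum.cong refl) (auto simp: walsh_orthogonal'[OF assms(1)])
  also have "\<dots> = (\<Sum>k<?N. ?P k k) * 2 ^ (2 * L)"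
    by (simp add: sum_distrib_left mult.commute)
  finally show ?thesis
    using assms by (simp add: spectral_form_factor_eq walsh_coeff_circuit_prob)
qed

lemma walsh_single_site:
  assumes "x < 2 * L"
  shows "walsh L (2 ^ x) i = of_int (spin i x)"
proof -
  have "walsh L (2 ^ x) i = (\<Prod>j<2 * L. if j = x then of_int (spin i x) else 1)"
    unfolding walsh_def by (intro prod.cong refl) (auto simp: bit_exp_iff spin_def)
  then show ?thesis using assms by simp
qed

text \<open>The string \<open>2 ^ x\<close> is a single Pauli matrix at site \<open>x\<close>, so
  its autocorrelation is one diagonal entry of the power of the transfer operator.\<close>

lemma one_point_sff_eq_trace:
  assumes "0 < L" "U \<in> carrier_mat 4 4"
  shows "one_point_sff U L t
    = (\<Sum>x<2 * L. kernel_power {..<2 ^ (2 * L)} (step_transfer L (\<lambda>r s. averaged_gate U $$ (r, s))) t (2 ^ x) (2 ^ x))"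
  unfolding one_point_sff_def
proof (intro sum.cong refl)
  fix x assume x: "x \<in> {..<2 * L}"
  then have "(2::nat) ^ x < 2 ^ (2 * L)" by simp
  moreover have "two_point U L x x t = walsh_coeff L (circuit_prob U L t) (2 ^ x) (2 ^ x)"
    using x by (simp add: two_point_eq[OF assms] walsh_coeff_def walsh_single_site)
  ultimately show "two_point U L x x t
      = kernel_power {..<2 ^ (2 * L)} (step_transfer L (\<lambda>r s. averaged_gate U $$ (r, s))) t (2 ^ x) (2 ^ x)"
    using walsh_coeff_circuit_prob[OF assms] by simp
qed

subsection \<open>Particle number\<close>

definition occupancy :: "nat \<Rightarrow> nat" where
  "occupancy r = of_bool (2 \<le> r) + of_bool (odd r)"

definition particle_number :: "nat \<Rightarrow> nat \<Rightarrow> nat" where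
  "particle_number L A = (\<Sum>j<2 * L. of_bool (bit A j))"

definition full_pairs :: "nat \<Rightarrow> nat \<Rightarrow> nat \<Rightarrow> nat" where
  "full_pairs L l A = (\<Sum>x<L. of_bool (pair_state L l x A = 3))"

lemma less_4_cases: "r < 4 \<Longrightarrow> r = 0 \<or> r = 1 \<or> r = 2 \<or> r = (3::nat)"
  by auto

lemma particle_number_eq:
  assumes "0 < L"
  shows "particle_number L A = (\<Sum>x<L. occupancy (pair_state L l x A))"
  unfolding particle_number_def sum_over_pairs[OF assms, where l = l]
  by (intro sum.cong refl) (simp add: occupancy_def bit_left_site[where L = L] bit_right_site)

lemma pair_state_eq_3: "pair_state L l x A = 3 \<longleftrightarrow> bit A (left_site l x) \<and> bit A (right_site L l x)"
  by (auto simp: pair_state_def)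

lemma full_pairs_le:
  assumes "0 < L"
  shows "2 * full_pairs L l A \<le> particle_number L A"
  unfolding particle_number_eq[OF assms, of A l] full_pairs_def sum_distrib_left
  by (intro sum_mono) (auto simp: occupancy_def)

lemma particle_number_le: "particle_number L A \<le> 2 * L"
  unfolding particle_number_def using sum_mono[of "{..<2 * L}" "\<lambda>j. of_bool (bit A j)" "\<lambda>_. 1::nat"] by simp

text \<open>The full pairs of the two layers are the edges of the cycle of all sites with both ends
  occupied.\<close>

lemma full_pairs_lt:
  assumes "0 < L" "0 < particle_number L A" "particle_number L A < 2 * L"
  shows "full_pairs L 0 A + full_pairs L 1 A < particle_number L A"
proof -
  let ?next = "\<lambda>j. (j + 1) mod (2 * L)"
  have "full_pairs L 0 A + full_pairs L 1 A = (\<Sum>j<2 * L. of_bool (bit A j \<and> bit A (?next j)))"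
    unfolding sum_over_pairs[OF assms(1), where l = 1] sum.distrib full_pairs_def pair_state_eq_3
    by (simp add: left_site_def right_site_def)
  also have "\<dots> < (\<Sum>j<2 * L. of_bool (bit A j))"
  proof (rule sum_strict_mono_ex1)
    \<comment> \<open>If every occupied site had an occupied successor, going round the ring would
      fill all sites. Hence some occupied site is followed by an empty one, which makes the
      inequality strict.\<close>
    have "\<exists>j<2 * L. bit A j \<and> \<not> bit A (?next j)"
    proof (rule ccontr)
      assume "\<not> ?thesis"
      then have closed: "bit A (?next j)" if "j < 2 * L" "bit A j" for j using that by blast
      have "\<exists>j<2 * L. bit A j"
      proof (rule ccontr)
        assume "\<not> ?thesis"
        then have "particle_number L A = 0"
          unfolding particle_number_def by (intro sum.neutral) auto
        then show False using assms(2) by simp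
      qed
      then obtain j where j: "j < 2 * L" "bit A j" by blast
      have "bit A ((j + i) mod (2 * L))" for i
      proof (induction i)
        case (Suc i)
        then show ?case
          using closed[of "(j + i) mod (2 * L)"] assms(1) by (simp add: mod_Suc_eq)
      qed (use j in simp)
      then have "bit A k" if "k < 2 * L" for k
        using that j(1) by (metis add_diff_inverse_nat add.assoc add.commute less_imp_add_positive
            mod_add_self1 mod_less not_less_iff_gr_or_eq le_add_diff_inverse less_or_eq_imp_le)
      then have "particle_number L A = 2 * L" by (simp add: particle_number_def)
      then show False using assms(3) by simp
    qed
    then show "\<exists>j\<in>{..<2 * L}. (of_bool (bit A j \<and> bit A (?next j)) :: nat) < of_bool (bit A j)"
      by auto
  qed auto
  finally show ?thesis unfolding particle_number_def .
qed

subsection \<open>Transfer operators of gates without splittings or without mergers\<close>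

text \<open>The block-diagonal part of the gate with respect to the number of particles.\<close>

definition conserving :: "(nat \<Rightarrow> nat \<Rightarrow> real) \<Rightarrow> nat \<Rightarrow> nat \<Rightarrow> real" where
  "conserving w r s = (if occupancy r = occupancy s then w r s else 0)"

text \<open>The sign \<open>\<kappa>\<close> is \<open>1\<close> without splittings and \<open>- 1\<close> without mergers.\<close>

locale directed_gate =
  fixes L :: nat and w :: "nat \<Rightarrow> nat \<Rightarrow> real" and a c g \<epsilon>1 \<epsilon>2 :: real and \<kappa> :: int
  assumes L_pos: "0 < L"
    and w_nonneg: "r < 4 \<Longrightarrow> s < 4 \<Longrightarrow> 0 \<le> w r s"
    and entries: "w 0 0 = 1" "w 1 1 = \<epsilon>1" "w 1 2 = a" "w 2 1 = c" "w 2 2 = \<epsilon>2" "w 3 3 = g"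
    and \<epsilon>_pos: "0 < \<epsilon>1" "0 < \<epsilon>2"
    and sign: "\<kappa> = 1 \<or> \<kappa> = - 1"
    and directed: "r < 4 \<Longrightarrow> s < 4 \<Longrightarrow> w r s \<noteq> 0 \<Longrightarrow> \<kappa> * int (occupancy r) \<le> \<kappa> * int (occupancy s)"
begin

abbreviation "states \<equiv> {..<2 ^ (2 * L) :: nat}"
abbreviation "lt \<equiv> layer_transfer L w"
abbreviation "lt' \<equiv> layer_transfer L (conserving w)"
abbreviation "step \<equiv> step_transfer L w"
abbreviation "num \<equiv> particle_number L"

definition sector :: "nat \<Rightarrow> nat set" where
  "sector n = {A \<in> states. num A = n}"

text \<open>The Perron eigenvalue of the one-particle gate followed by the exchange of left and
  right, that is, the larger root of \<open>(x - a) * (x - c) = \<epsilon>1 * \<epsilon>2\<close>.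
  It is the rate per layer, so a step of two layers contributes \<open>growth\<^sup>2\<close>, the
  \<lambda> of the theorem.\<close>

definition growth :: real where
  "growth = ((a + c) + sqrt (4 * \<epsilon>1 * \<epsilon>2 + (a - c)\<^sup>2)) / 2"

lemma finite_sector: "finite (sector n)"
  by (simp add: sector_def)

lemma a_nonneg: "0 \<le> a" and c_nonneg: "0 \<le> c" and g_nonneg: "0 \<le> g"
  using w_nonneg[of 1 2] w_nonneg[of 2 1] w_nonneg[of 3 3] unfolding entries by simp_all

lemma growth_gt: "a < growth" "c < growth"
proof -
  have "0 < \<epsilon>1 * \<epsilon>2" using \<epsilon>_pos by simp
  then have "\<bar>a - c\<bar> < sqrt (4 * \<epsilon>1 * \<epsilon>2 + (a - c)\<^sup>2)"
    by (intro real_less_rsqrt) (simp add: mult.assoc)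
  then show "a < growth" "c < growth" by (auto simp: growth_def)
qed

lemma growth_pos: "0 < growth"
  using growth_gt a_nonneg by linarith

lemma growth_eq: "(growth - a) * (growth - c) = \<epsilon>1 * \<epsilon>2"
proof -
  have "(growth - a) * (growth - c) = (sqrt (4 * \<epsilon>1 * \<epsilon>2 + (a - c)\<^sup>2) ^ 2 - (a - c)\<^sup>2) / 4"
    by (simp add: growth_def power2_eq_square field_simps)
  moreover have "0 \<le> 4 * \<epsilon>1 * \<epsilon>2 + (a - c)\<^sup>2" using \<epsilon>_pos by simp
  ultimately show ?thesis by simp
qed

lemma lt_nonneg: "0 \<le> lt l A B"
  unfolding layer_transfer_def by (intro prod_nonneg) (simp add: w_nonneg pair_state_lt)

lemma step_nonneg: "0 \<le> step A B"
  unfolding step_transfer_def by (intro sum_nonneg mult_nonneg_nonneg lt_nonneg)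

lemma lt_directed:
  assumes "lt l A B \<noteq> 0"
  shows "\<kappa> * int (num A) \<le> \<kappa> * int (num B)"
proof -
  have "w (pair_state L l x A) (pair_state L l x B) \<noteq> 0" if "x < L" for x
    using assms that by (auto simp: layer_transfer_def)
  then show ?thesis
    unfolding particle_number_eq[OF L_pos, of _ l] of_nat_sum sum_distrib_left
    by (intro sum_mono directed) (auto simp: pair_state_lt)
qed

lemma step_directed:
  assumes "step A B \<noteq> 0"
  shows "\<kappa> * int (num A) \<le> \<kappa> * int (num B)"
proof -
  obtain C where "lt 0 A C * lt 1 C B \<noteq> 0"
    using assms unfolding step_transfer_def by (auto elim: sum.not_neutral_contains_not_neutral)
  then show ?thesis using lt_directed[of 0 A C] lt_directed[of 1 C B] by auto
qed

text \<open>A gate can change the number of particles only in the direction given by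
  \<open>\<kappa>\<close>; if the totals agree, no gate can have changed it.\<close>

lemma lt_eq_conserving:
  assumes "num A = num B"
  shows "lt l A B = lt' l A B"
proof (cases "\<forall>x<L. occupancy (pair_state L l x A) = occupancy (pair_state L l x B)")
  case True
  then show ?thesis
    unfolding layer_transfer_def by (intro prod.cong refl) (simp add: conserving_def)
next
  case False
  then have "lt' l A B = 0"
    by (auto simp: layer_transfer_def conserving_def)
  moreover have "lt l A B = 0"
  proof (rule ccontr)
    assume "lt l A B \<noteq> 0"
    then have "w (pair_state L l x A) (pair_state L l x B) \<noteq> 0" if "x < L" for x
      using that by (auto simp: layer_transfer_def)
    then have le: "\<kappa> * int (occupancy (pair_state L l x A)) \<le> \<kappa> * int (occupancy (pair_state L l x B))"
      if "x < L" for x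
      using that by (intro directed pair_state_lt)
    have "(\<Sum>x<L. \<kappa> * int (occupancy (pair_state L l x A))) = (\<Sum>x<L. \<kappa> * int (occupancy (pair_state L l x B)))"
      using arg_cong[OF assms, of "\<lambda>n. \<kappa> * int n"]
      unfolding particle_number_eq[OF L_pos, of _ l] of_nat_sum sum_distrib_left .
    then have "\<kappa> * int (occupancy (pair_state L l x A)) = \<kappa> * int (occupancy (pair_state L l x B))"
      if "x < L" for x
      using that by (intro sum_mono_inv[OF _ le]) auto
    then show False using False sign by auto
  qed
  ultimately show ?thesis by simp
qed

text \<open>A conserving gate keeps the occupancy of its pair, and the full pair is the only state
  of occupancy 2.\<close>

lemma lt'_nonzero:
  assumes "lt' l A B \<noteq> 0"
  shows "num A = num B" "full_pairs L l A = full_pairs L l B"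
proof -
  have occ: "occupancy (pair_state L l x A) = occupancy (pair_state L l x B)" if "x < L" for x
    using assms that by (auto simp: layer_transfer_def conserving_def split: if_splits)
  then show "num A = num B" by (simp add: particle_number_eq[OF L_pos, of _ l])
  have "pair_state L l x A = 3 \<longleftrightarrow> pair_state L l x B = 3" if "x < L" for x
    using occ[OF that] less_4_cases[OF pair_state_lt[of L l x A]] less_4_cases[OF pair_state_lt[of L l x B]]
    by (auto simp: occupancy_def)
  then show "full_pairs L l A = full_pairs L l B" by (simp add: full_pairs_def)
qed

lemma lt'_nonneg: "0 \<le> lt' l A B"
  unfolding layer_transfer_def
  by (intro prod_nonneg) (simp add: conserving_def w_nonneg pair_state_lt)

text \<open>The number of particles of the intermediate state is squeezed between the equal numbers
  at both ends.\<close>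

lemma step_eq_conserving:
  assumes "num A = num B"
  shows "step A B = (\<Sum>C\<in>states. lt' 0 A C * lt' 1 C B)"
  unfolding step_transfer_def
proof (intro sum.cong refl)
  fix C
  show "lt 0 A C * lt 1 C B = lt' 0 A C * lt' 1 C B"
  proof (cases "num C = num A")
    case True
    then show ?thesis using assms by (simp add: lt_eq_conserving)
  next
    case False
    then have "lt' 0 A C = 0" using lt'_nonzero(1) by fastforce
    moreover have "lt 0 A C * lt 1 C B = 0"
      using lt_directed[of 0 A C] lt_directed[of 1 C B] assms False sign by fastforce
    ultimately show ?thesis by simp
  qed
qed

text \<open>The Perron eigenvector of the one-particle gate followed by the exchange of left and right.\<close>

definition site_weight :: "bool \<Rightarrow> real" where
  "site_weight left = (if left then growth - a else \<epsilon>1)"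

text \<open>The argument \<open>l\<close> is the layer about to act: a site that is left in one
  layer is right in the other, so the weight alternates with the layers.\<close>

definition weight :: "nat \<Rightarrow> nat \<Rightarrow> real" where
  "weight l A = (\<Prod>j<2 * L. if bit A j then site_weight (even j \<longleftrightarrow> l \<noteq> 0) else 1)"

lemma weight_pos: "0 < weight l A"
  unfolding weight_def using growth_gt \<epsilon>_pos by (intro prod_pos) (auto simp: site_weight_def)

lemma weight_eq_prod_pairs:
  "weight l' A = (\<Prod>x<L. (if 2 \<le> pair_state L l x A then site_weight ((l \<noteq> 0) = (l' \<noteq> 0)) else 1)
    * (if odd (pair_state L l x A) then site_weight ((l = 0) = (l' \<noteq> 0)) else 1))"
  unfolding weight_def prod_over_pairs[OF L_pos, where l = l]
  by (intro prod.cong refl)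
     (simp add: bit_left_site[where L = L] bit_right_site even_left_site even_right_site)

text \<open>For one particle this is the eigenvector equation of \<open>growth\<close>; left and
  right are exchanged between the two sides because the next layer pairs the sites differently. For
  \<open>r = 3\<close> the factor \<open>g / growth\<^sup>2\<close> corrects the product of two
  one-particle rates to the actual entry \<open>g\<close>.\<close>

lemma gate_weight:
  assumes "r < 4"
  shows "(\<Sum>s<4. conserving w r s * ((if 2 \<le> s then site_weight False else 1) * (if odd s then site_weight True else 1)))
    = growth ^ occupancy r * (g / growth\<^sup>2) ^ of_bool (r = 3)
      * ((if 2 \<le> r then site_weight True else 1) * (if odd r then site_weight False else 1))"
proof -
  have "c * (growth - a) + \<epsilon>2 * \<epsilon>1 = growth * (growth - a)"
    using growth_eq by (simp add: algebra_simps)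
  then show ?thesis
    using less_4_cases[OF assms] growth_pos entries
    by (auto simp: sum_lessThan_4 conserving_def occupancy_def site_weight_def algebra_simps power2_eq_square)
qed

section \<open>Action of layers and steps on the weights\<close>

lemma layer_weight:
  assumes "(l' = 0) = (l \<noteq> 0)"
  shows "(\<Sum>B\<in>states. lt' l A B * weight l' B)
    = growth ^ num A * (g / growth\<^sup>2) ^ full_pairs L l A * weight l A"
proof -
  let ?p = "pair_state L l"
  let ?v = "\<lambda>b r. (if 2 \<le> r then site_weight b else 1) * (if odd r then site_weight (\<not> b) else 1)"
  have other: "weight l' B = (\<Prod>x<L. ?v False (?p x B))" for B
    unfolding weight_eq_prod_pairs[of l' B l] using assms by (intro prod.cong refl) auto
  have same: "weight l A = (\<Prod>x<L. ?v True (?p x A))"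
    unfolding weight_eq_prod_pairs[of l A l] by (intro prod.cong refl) (cases "l = 0"; auto)
  have "(\<Sum>B\<in>states. lt' l A B * weight l' B)
      = (\<Sum>B<2 ^ (2 * L). \<Prod>x<L. conserving w (?p x A) (?p x B) * ?v False (?p x B))"
    unfolding other layer_transfer_def prod.distrib ..
  also have "\<dots> = (\<Prod>x<L. \<Sum>s<4. conserving w (?p x A) s * ?v False s)"
    by (rule sum_prod_pair_states[OF L_pos])
  also have "\<dots> = (\<Prod>x<L. growth ^ occupancy (?p x A) * (g / growth\<^sup>2) ^ of_bool (?p x A = 3) * ?v True (?p x A))"
    by (intro prod.cong refl)
       (simp only: gate_weight[OF pair_state_lt] not_True_eq_False not_False_eq_True)
  also have "\<dots> = growth ^ num A * (g / growth\<^sup>2) ^ full_pairs L l A * weight l A"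
    unfolding prod.distrib same particle_number_eq[OF L_pos, of A l] full_pairs_def power_sum ..
  finally show ?thesis .
qed

lemma layer_weight_0: "(\<Sum>B\<in>states. lt' 0 A B * weight 1 B)
    = growth ^ num A * (g / growth\<^sup>2) ^ full_pairs L 0 A * weight 0 A"
  and layer_weight_1: "(\<Sum>B\<in>states. lt' 1 A B * weight 0 B)
    = growth ^ num A * (g / growth\<^sup>2) ^ full_pairs L 1 A * weight 1 A"
  by (rule layer_weight, simp)+

lemma sum_sector_step:
  assumes "A \<in> states"
  shows "(\<Sum>B\<in>sector (num A). step A B * v B) = (\<Sum>C\<in>states. lt' 0 A C * (\<Sum>B\<in>states. lt' 1 C B * v B))"
proof -
  have "(\<Sum>B\<in>sector (num A). step A B * v B)
      = (\<Sum>B\<in>sector (num A). (\<Sum>C\<in>states. lt' 0 A C * lt' 1 C B) * v B)"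
    by (intro sum.cong refl) (simp add: sector_def step_eq_conserving)
  also have "\<dots> = (\<Sum>B\<in>states. (\<Sum>C\<in>states. lt' 0 A C * lt' 1 C B) * v B)"
  proof (intro sum.mono_neutral_left ballI)
    fix B assume B: "B \<in> states - sector (num A)"
    have "lt' 0 A C * lt' 1 C B = 0" for C
      using lt'_nonzero(1)[of 0 A C] lt'_nonzero(1)[of 1 C B] B
      by (cases "lt' 0 A C = 0"; cases "lt' 1 C B = 0") (auto simp: sector_def simp del: One_nat_def)
    then show "(\<Sum>C\<in>states. lt' 0 A C * lt' 1 C B) * v B = 0" by simp
  qed (auto simp: sector_def)
  also have "\<dots> = (\<Sum>B\<in>states. \<Sum>C\<in>states. lt' 0 A C * lt' 1 C B * v B)"
    by (simp only: sum_distrib_right)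
  also have "\<dots> = (\<Sum>C\<in>states. \<Sum>B\<in>states. lt' 0 A C * lt' 1 C B * v B)"
    by (rule sum.swap)
  also have "\<dots> = (\<Sum>C\<in>states. lt' 0 A C * (\<Sum>B\<in>states. lt' 1 C B * v B))"
    by (simp only: sum_distrib_left mult.assoc)
  finally show ?thesis .
qed

text \<open>The full pairs met in layer 1 are those of the intermediate state \<open>C\<close>,
  which is only known to share with \<open>A\<close> the number of particles and the number of full
  pairs of layer 0. The constant \<open>K\<close> is a bound uniform over such
  \<open>C\<close>.\<close>

lemma step_weight_le:
  assumes A: "A \<in> states"
    and K: "\<And>C. C \<in> states \<Longrightarrow> num C = num A \<Longrightarrow> full_pairs L 0 C = full_pairs L 0 A \<Longrightarrow>
      (g / growth\<^sup>2) ^ full_pairs L 1 C \<le> K"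
  shows "(\<Sum>B\<in>sector (num A). step A B * weight 0 B)
    \<le> growth ^ (2 * num A) * (K * (g / growth\<^sup>2) ^ full_pairs L 0 A) * weight 0 A"
proof -
  have "(\<Sum>B\<in>sector (num A). step A B * weight 0 B)
      = (\<Sum>C\<in>states. lt' 0 A C * (growth ^ num C * (g / growth\<^sup>2) ^ full_pairs L 1 C * weight 1 C))"
    unfolding sum_sector_step[OF A] layer_weight_1 ..
  also have "\<dots> \<le> (\<Sum>C\<in>states. (growth ^ num A * K) * (lt' 0 A C * weight 1 C))"
  proof (intro sum_mono)
    fix C assume C: "C \<in> states"
    show "lt' 0 A C * (growth ^ num C * (g / growth\<^sup>2) ^ full_pairs L 1 C * weight 1 C)
        \<le> (growth ^ num A * K) * (lt' 0 A C * weight 1 C)"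
    proof (cases "lt' 0 A C = 0")
      case False
      then have eq: "num C = num A" "full_pairs L 0 C = full_pairs L 0 A"
        using lt'_nonzero[OF False] by simp_all
      have "(g / growth\<^sup>2) ^ full_pairs L 1 C * (growth ^ num A * (lt' 0 A C * weight 1 C))
          \<le> K * (growth ^ num A * (lt' 0 A C * weight 1 C))"
        using K[OF C eq] growth_pos weight_pos[of 1 C] lt'_nonneg[of 0 A C] by (intro mult_right_mono) auto
      then show ?thesis unfolding eq by (simp add: mult_ac)
    qed simp
  qed
  also have "\<dots> = growth ^ num A * K * (growth ^ num A * (g / growth\<^sup>2) ^ full_pairs L 0 A * weight 0 A)"
    by (simp only: sum_distrib_left[symmetric] layer_weight_0)
  also have "\<dots> = growth ^ (2 * num A) * (K * (g / growth\<^sup>2) ^ full_pairs L 0 A) * weight 0 A"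
    by (simp add: mult_2 power_add mult_ac)
  finally show ?thesis .
qed

text \<open>A single particle never fills a pair, so the correction factors are absent and the
  weight is an exact eigenvector.\<close>

lemma step_weight_one_particle:
  assumes "A \<in> sector 1"
  shows "(\<Sum>B\<in>sector 1. step A B * weight 0 B) = growth\<^sup>2 * weight 0 A"
proof -
  have A: "A \<in> states" "num A = 1" using assms by (auto simp: sector_def)
  have none: "full_pairs L l B = 0" if "num B = 1" for l B
    using full_pairs_le[OF L_pos, of l B] that by simp
  have "(\<Sum>B\<in>sector (num A). step A B * weight 0 B)
      = (\<Sum>C\<in>states. lt' 0 A C * (growth ^ num C * (g / growth\<^sup>2) ^ full_pairs L 1 C * weight 1 C))"
    unfolding sum_sector_step[OF A(1)] layer_weight_1 ..
  also have "\<dots> = (\<Sum>C\<in>states. growth * (lt' 0 A C * weight 1 C))"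
  proof (intro sum.cong refl)
    fix C
    show "lt' 0 A C * (growth ^ num C * (g / growth\<^sup>2) ^ full_pairs L 1 C * weight 1 C)
        = growth * (lt' 0 A C * weight 1 C)"
    proof (cases "lt' 0 A C = 0")
      case False
      then have "num C = 1" using lt'_nonzero(1)[of 0 A C] A(2) by simp
      then show ?thesis by (simp add: none)
    qed simp
  qed
  also have "\<dots> = growth * (growth * weight 0 A)"
    unfolding sum_distrib_left[symmetric] layer_weight_0 by (simp add: A(2) none[OF A(2)])
  finally show ?thesis using A(2) by (simp add: power2_eq_square)
qed

text \<open>The step is block triangular in the number of particles, and the diagonal of a power
  sees only the diagonal blocks.\<close>

lemma kernel_power_sector:
  assumes "A \<in> states"
  shows "kernel_power states step t A A = kernel_power (sector (num A)) step t A A"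
proof -
  have "kernel_power states step t A A
      = kernel_power {C \<in> states. \<kappa> * int (num C) = \<kappa> * int (num A)} step t A A"
    using assms step_directed by (intro kernel_power_block) auto
  also have "{C \<in> states. \<kappa> * int (num C) = \<kappa> * int (num A)} = sector (num A)"
    using sign by (auto simp: sector_def)
  finally show ?thesis .
qed

lemma kernel_power_sector_le:
  assumes A: "A \<in> states" and "0 \<le> \<mu>"
    and super: "\<And>B. B \<in> sector (num A) \<Longrightarrow>
      (\<Sum>C\<in>sector (num A). step B C * weight 0 C) \<le> \<mu> * weight 0 B"
  shows "kernel_power states step t A A \<le> \<mu> ^ t"
  unfolding kernel_power_sector[OF A]
  using assms by (intro kernel_power_supersolution[where v = "weight 0"])
    (auto simp: finite_sector step_nonneg weight_pos sector_def)

text \<open>With \<gamma> denoting \<open>g / growth\<^sup>2\<close>, the rate for \<open>n\<close>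
  particles is bounded by \<open>growth ^ (2 * n)\<close> times a power of \<gamma> that counts the
  full pairs met in the two layers. For \<gamma> at most 1 this power is dropped, otherwise its
  exponent is replaced by the largest possible one.\<close>

lemma kernel_power_many_particles_le:
  assumes A: "A \<in> states" "2 \<le> num A"
    and "growth\<^sup>2 < 1" "g < 1"
    and \<mu>: "growth\<^sup>2 * growth\<^sup>2 \<le> \<mu>" "growth\<^sup>2 * g \<le> \<mu>" "g ^ (2 * L) \<le> \<mu>"
  shows "kernel_power states step t A A \<le> \<mu> ^ t"
proof (rule kernel_power_sector_le[OF A(1)])
  show "0 \<le> \<mu>" using \<mu>(1) zero_le_square[of "growth\<^sup>2"] by linarith
  fix B assume "B \<in> sector (num A)"
  then have B: "B \<in> states" "num B = num A" by (auto simp: sector_def)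
  define \<gamma> where "\<gamma> = g / growth\<^sup>2"
  have "0 < growth\<^sup>2" using growth_pos by simp
  have \<gamma>: "0 \<le> \<gamma>" "growth\<^sup>2 * \<gamma> = g"
    using g_nonneg growth_pos by (simp_all add: \<gamma>_def)
  note bound = step_weight_le[OF B(1), folded \<gamma>_def]
  have goal: "(\<Sum>C\<in>sector (num A). step B C * weight 0 C) \<le> \<mu> * weight 0 B"
    if K: "\<And>C. C \<in> states \<Longrightarrow> num C = num B \<Longrightarrow> full_pairs L 0 C = full_pairs L 0 B \<Longrightarrow>
      \<gamma> ^ full_pairs L 1 C \<le> K" and le: "(growth\<^sup>2) ^ num B * (K * \<gamma> ^ full_pairs L 0 B) \<le> \<mu>" for K
  proof -
    have "(\<Sum>C\<in>sector (num B). step B C * weight 0 C)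
        \<le> growth ^ (2 * num B) * (K * \<gamma> ^ full_pairs L 0 B) * weight 0 B"
      by (rule bound[OF K])
    also have "\<dots> \<le> \<mu> * weight 0 B"
      unfolding power_mult by (rule mult_right_mono[OF le less_imp_le[OF weight_pos]])
    finally show ?thesis unfolding B(2) .
  qed
  show "(\<Sum>C\<in>sector (num A). step B C * weight 0 C) \<le> \<mu> * weight 0 B"
  proof (cases "\<gamma> \<le> 1")
    case True
    show ?thesis
    proof (rule goal[of 1])
      have "(growth\<^sup>2) ^ num B * (1 * \<gamma> ^ full_pairs L 0 B) \<le> (growth\<^sup>2) ^ num B"
        using True \<gamma>(1) growth_pos by (simp add: power_le_one mult_left_le)
      also have "\<dots> \<le> (growth\<^sup>2) ^ 2"
        using A(2) B(2) assms(3) by (intro power_decreasing) auto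
      also have "\<dots> \<le> \<mu>" using \<mu>(1) by (simp add: power2_eq_square)
      finally show "(growth\<^sup>2) ^ num B * (1 * \<gamma> ^ full_pairs L 0 B) \<le> \<mu>" .
    qed (simp add: True \<gamma>(1) power_le_one)
  next
    case False
    then have "1 < \<gamma>" by simp
    \<comment> \<open>A bound for the number of full pairs in both layers together: one per particle
      on the full ring, and at least one fewer if some site is empty.\<close>
    define m where "m = (if num B = 2 * L then num B else num B - 1)"
    have edges: "full_pairs L 0 C + full_pairs L 1 C \<le> m" if "num C = num B" for C
    proof (cases "num B = 2 * L")
      case True
      then show ?thesis
        using full_pairs_le[OF L_pos, of 0 C] full_pairs_le[OF L_pos, of 1 C] that by (simp add: m_def)
    next
      case False
      then show ?thesis
        using full_pairs_lt[OF L_pos, of C] particle_number_le[of L C] that A(2) B(2) by (simp add: m_def)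
    qed
    \<comment> \<open>Layer 1 can meet at most what layer 0 has left of the total \<open>m\<close>;
      the subtraction is not truncated since \<open>full_pairs L 0 B \<le> m\<close>.\<close>
    show ?thesis
    proof (rule goal[of "\<gamma> ^ (m - full_pairs L 0 B)"])
      fix C assume "C \<in> states" "num C = num B" "full_pairs L 0 C = full_pairs L 0 B"
      then have "full_pairs L 1 C \<le> m - full_pairs L 0 B" using edges[of C] by simp
      then show "\<gamma> ^ full_pairs L 1 C \<le> \<gamma> ^ (m - full_pairs L 0 B)"
        using \<open>1 < \<gamma>\<close> by (intro power_increasing) auto
    next
      have "full_pairs L 0 B \<le> m" using edges[of B] by simp
      then have "(growth\<^sup>2) ^ num B * (\<gamma> ^ (m - full_pairs L 0 B) * \<gamma> ^ full_pairs L 0 B) = (growth\<^sup>2) ^ num B * \<gamma> ^ m"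
        by (simp add: power_add[symmetric])
      also have "\<dots> \<le> \<mu>"
      proof (cases "num B = 2 * L")
        case True
        then have "(growth\<^sup>2) ^ num B * \<gamma> ^ m = g ^ (2 * L)"
          unfolding m_def by (simp add: power_mult_distrib[symmetric] \<gamma>(2) del: power_mult_distrib power_even_abs)
        then show ?thesis using \<mu>(3) by simp
      next
        case False
        \<comment> \<open>Here \<open>m\<close> is \<open>Suc k\<close>: one factor
          \<open>growth\<^sup>2\<close> finds no \<gamma> to combine with, the others give
          \<open>g ^ Suc k\<close>, of which one \<open>g\<close> is kept and the rest is at most
          1.\<close>
        obtain k where k: "num B = Suc (Suc k)"
          using A(2) B(2) by (metis Suc_le_D numeral_2_eq_2 Suc_le_mono)
        have "(growth\<^sup>2) ^ num B * \<gamma> ^ m = growth\<^sup>2 * (growth\<^sup>2 * \<gamma>) ^ Suc k"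
          using False k by (simp add: m_def power_mult_distrib)
        also have "\<dots> = growth\<^sup>2 * g * g ^ k" by (simp add: \<gamma>(2))
        also have "\<dots> \<le> growth\<^sup>2 * g * 1"
          using g_nonneg assms(4) by (intro mult_left_mono power_le_one) auto
        also have "\<dots> \<le> \<mu>" using \<mu>(2) by simp
        finally show ?thesis .
      qed
      finally show "(growth\<^sup>2) ^ num B * (\<gamma> ^ (m - full_pairs L 0 B) * \<gamma> ^ full_pairs L 0 B) \<le> \<mu>" .
    qed
  qed
qed

end

subsection \<open>One particle\<close>

lemma particle_number_single: "x < 2 * L \<Longrightarrow> particle_number L (2 ^ x) = 1"
proof -
  assume "x < 2 * L"
  moreover have "particle_number L (2 ^ x) = (\<Sum>j<2 * L. if j = x then 1 else 0)"
    unfolding particle_number_def by (intro sum.cong refl) (auto simp: bit_exp_iff)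
  ultimately show ?thesis by simp
qed

lemma particle_number_0: "particle_number L 0 = 0"
  by (simp add: particle_number_def)

lemma particle_number_eq_0:
  assumes "A < 2 ^ (2 * L)" "particle_number L A = 0"
  shows "A = 0"
proof (rule nat_eq_if_low_bits_eq[OF assms(1)])
  fix j assume "j < 2 * L"
  then show "bit A j = bit 0 j"
    using assms(2) unfolding particle_number_def by (subst (asm) sum_eq_0_iff) auto
qed simp

lemma particle_number_eq_1:
  assumes "A < 2 ^ (2 * L)" "particle_number L A = 1"
  shows "\<exists>x<2 * L. A = 2 ^ x"
proof -
  have "particle_number L A = card {j. j < 2 * L \<and> bit A j}"
    unfolding particle_number_def by (simp add: Int_def)
  then obtain x where x: "{j. j < 2 * L \<and> bit A j} = {x}"
    using assms(2) card_1_singletonE by metis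
  then have "x < 2 * L" by auto
  moreover have "A = 2 ^ x"
  proof (rule nat_eq_if_low_bits_eq[OF assms(1)])
    show "(2::nat) ^ x < 2 ^ (2 * L)" using \<open>x < 2 * L\<close> by simp
    fix j assume "j < 2 * L"
    then show "bit A j = bit ((2::nat) ^ x) j" using x by (auto simp: bit_exp_iff)
  qed
  ultimately show ?thesis by blast
qed

lemma pair_state_left_site:
  assumes "x < L" "y < L"
  shows "pair_state L l x (2 ^ left_site l y) = (if x = y then 2 else 0)"
proof -
  have "left_site l y \<noteq> right_site L l x"
    by (metis even_left_site even_right_site)
  then show ?thesis
    using inj_onD[OF inj_on_left_site[of l L], of x y] assms by (auto simp: pair_state_def bit_exp_iff)
qed

lemma pair_state_right_site:
  assumes "x < L" "y < L"
  shows "pair_state L l x (2 ^ right_site L l y) = (if x = y then 1 else 0)"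
proof -
  have "right_site L l y \<noteq> left_site l x"
    by (metis even_left_site even_right_site)
  then show ?thesis
    using inj_onD[OF inj_on_right_site[of L l], of x y] assms by (auto simp: pair_state_def bit_exp_iff)
qed

section \<open>Hops of a single particle and the trace of its block\<close>

context directed_gate
begin

lemma sector_1: "sector 1 = (\<lambda>x. 2 ^ x) ` {..<2 * L}"
  using particle_number_eq_1 particle_number_single[of _ L] by (fastforce simp: sector_def)

lemma lt_single:
  assumes "y < L" and "\<And>x. x < L \<Longrightarrow> pair_state L l x A = (if x = y then r else 0)"
    and "\<And>x. x < L \<Longrightarrow> pair_state L l x B = (if x = y then s else 0)"
  shows "lt l A B = w r s"
proof -
  have "lt l A B = (\<Prod>x<L. if x = y then w r s else 1)"
    unfolding layer_transfer_def using assms by (intro prod.cong refl) (simp add: entries)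
  then show ?thesis using assms(1) by simp
qed

lemma lt_hop:
  assumes "y < L"
  shows "lt l (2 ^ right_site L l y) (2 ^ right_site L l y) = \<epsilon>1"
    and "lt l (2 ^ right_site L l y) (2 ^ left_site l y) = a"
    and "lt l (2 ^ left_site l y) (2 ^ right_site L l y) = c"
    and "lt l (2 ^ left_site l y) (2 ^ left_site l y) = \<epsilon>2"
  unfolding entries(2-5)[symmetric]
  by (intro lt_single[OF assms] pair_state_left_site pair_state_right_site assms; assumption)+

lemma lt_stay:
  assumes "j < 2 * L"
  shows "lt l (2 ^ j) (2 ^ j) = (if even j \<longleftrightarrow> l \<noteq> 0 then \<epsilon>2 else \<epsilon>1)"
proof -
  have "j \<in> left_site l ` {..<L} \<union> right_site L l ` {..<L}"
    unfolding sites_image[OF L_pos] using assms by auto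
  then show ?thesis
    by (auto simp: lt_hop even_left_site even_right_site)
qed

lemma step_ge:
  assumes "D < 2 * L"
  shows "lt 0 A (2 ^ D) * lt 1 (2 ^ D) B \<le> step A B"
  unfolding step_transfer_def using assms
  by (intro member_le_sum[where f = "\<lambda>D. lt 0 A D * lt 1 D B"]) (auto intro!: mult_nonneg_nonneg lt_nonneg)

text \<open>A site is left in one layer and right in the other, so staying put through both layers
  has weight \<open>\<epsilon>1 * \<epsilon>2\<close>.\<close>

lemma step_stay:
  assumes "j < 2 * L"
  shows "\<epsilon>1 * \<epsilon>2 \<le> step (2 ^ j) (2 ^ j)"
  using step_ge[OF assms, of "2 ^ j" "2 ^ j"] unfolding lt_stay[OF assms]
  by (simp add: mult.commute split: if_splits)

text \<open>An odd site waits in layer 0 and hops in layer 1; an even site hops in both layers. Site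
  0 is excluded because its left neighbour lies across the boundary, where the index would jump
  up.\<close>

lemma step_left_pos:
  assumes "0 < a" "j < 2 * L" "j \<noteq> 0"
  shows "\<exists>k<j. 0 < step (2 ^ j) (2 ^ k)"
proof (cases "odd j")
  case True
  then obtain y where y: "j = 2 * y + 1" by (rule oddE)
  have "0 < lt 0 (2 ^ j) (2 ^ j) * lt 1 (2 ^ j) (2 ^ (2 * y))"
    using lt_stay[OF assms(2), of 0] lt_hop(2)[of y 1] y assms \<epsilon>_pos True
    by (simp add: right_site_def left_site_def)
  then show ?thesis using step_ge[OF assms(2), of "2 ^ j" "2 ^ (2 * y)"] y
    by (intro exI[of _ "2 * y"]) linarith
next
  case False
  then obtain y where "j = 2 * y" by blast
  with assms(3) obtain y where y: "j = 2 * y + 2" by (cases y) auto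
  have "0 < lt 0 (2 ^ j) (2 ^ (2 * y + 1)) * lt 1 (2 ^ (2 * y + 1)) (2 ^ (2 * y))"
    using lt_hop(2)[of y 0] lt_hop(2)[of y 1] y assms(1,2)
    by (simp add: right_site_def left_site_def)
  then show ?thesis using step_ge[of "2 * y + 1" "2 ^ j" "2 ^ (2 * y)"] y assms(2)
    by (intro exI[of _ "2 * y"]) linarith
qed

text \<open>Mirror image of the motion to the left: even sites wait in layer 0 and odd sites hop in
  both layers. The last site is excluded since its right neighbour is site 0.\<close>

lemma step_right_pos:
  assumes "0 < c" "j < 2 * L" "j \<noteq> 2 * L - 1"
  shows "\<exists>k>j. k < 2 * L \<and> 0 < step (2 ^ j) (2 ^ k)"
proof (cases "odd j")
  case True
  then obtain y where y: "j = 2 * y + 1" by (rule oddE)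
  have "0 < lt 0 (2 ^ j) (2 ^ (2 * y + 2)) * lt 1 (2 ^ (2 * y + 2)) (2 ^ (2 * y + 3))"
    using lt_hop(3)[of y 0] lt_hop(3)[of "y + 1" 1] y assms
    by (simp add: right_site_def left_site_def eval_nat_numeral)
  moreover have "2 * y + 3 < 2 * L" using y assms(2,3) by presburger
  ultimately show ?thesis using step_ge[of "2 * y + 2" "2 ^ j" "2 ^ (2 * y + 3)"] y
    by (intro exI[of _ "2 * y + 3"] conjI) linarith+
next
  case False
  then obtain y where y: "j = 2 * y" by blast
  have "0 < lt 0 (2 ^ j) (2 ^ j) * lt 1 (2 ^ j) (2 ^ (2 * y + 1))"
    using lt_stay[OF assms(2), of 0] lt_hop(3)[of y 1] y assms \<epsilon>_pos False
    by (simp add: right_site_def left_site_def)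
  then show ?thesis using step_ge[OF assms(2), of "2 ^ j" "2 ^ (2 * y + 1)"] y assms
    by (intro exI[of _ "2 * y + 1"]) auto
qed

definition one_particle_trace :: "nat \<Rightarrow> real" where
  "one_particle_trace t = (\<Sum>x<2 * L. kernel_power states step t (2 ^ x) (2 ^ x))"

lemma one_particle_trace_eq:
  "one_particle_trace t = (\<Sum>A\<in>sector 1. kernel_power (sector 1) step t A A)"
proof -
  have "(\<Sum>A\<in>sector 1. kernel_power (sector 1) step t A A) = (\<Sum>A\<in>sector 1. kernel_power states step t A A)"
    by (intro sum.cong refl) (auto simp: sector_def kernel_power_sector)
  then show ?thesis
    unfolding one_particle_trace_def sector_1 by (simp add: sum.reindex inj_on_def)
qed

text \<open>If \<open>a\<close> is positive the particle can drift to site 0, otherwise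
  \<open>c\<close> is positive and it can drift to the last site; staying provides the loop there.
  Convergence then follows with \<open>weight 0\<close> as eigenvector.\<close>

lemma one_particle_trace_asymp:
  assumes "0 < a + c"
  shows "(\<lambda>t. one_particle_trace t / (growth\<^sup>2) ^ t) \<longlonglongrightarrow> 1"
proof -
  have "\<exists>z \<in> sector 1. \<exists>rank :: nat \<Rightarrow> nat.
      \<forall>A \<in> sector 1. A \<noteq> z \<longrightarrow> (\<exists>B\<in>sector 1. rank B < rank A \<and> 0 < step A B)"
  proof (cases "0 < a")
    case True
    have "\<exists>B\<in>sector 1. B < A \<and> 0 < step A B" if A: "A \<in> sector 1" "A \<noteq> 2 ^ 0" for A
    proof -
      obtain j where j: "j < 2 * L" "A = 2 ^ j" using A(1) unfolding sector_1 by blast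
      with A(2) have "j \<noteq> 0" by auto
      from step_left_pos[OF True j(1) this] obtain k where "k < j" "0 < step (2 ^ j) (2 ^ k)" by blast
      then show ?thesis using j unfolding sector_1 by (intro bexI[of _ "2 ^ k"]) auto
    qed
    moreover have "2 ^ 0 \<in> sector 1" unfolding sector_1 using L_pos by (intro imageI) auto
    ultimately show ?thesis by (intro bexI[of _ "2 ^ 0"] exI[of _ "\<lambda>A. A"]) auto
  next
    case False
    then have "0 < c" using assms a_nonneg by simp
    \<comment> \<open>The rank \<open>2 ^ (2 * L) - A\<close> decreases as the particle moves
      right.\<close>
    have "\<exists>B\<in>sector 1. 2 ^ (2 * L) - B < 2 ^ (2 * L) - A \<and> 0 < step A B"
      if A: "A \<in> sector 1" "A \<noteq> 2 ^ (2 * L - 1)" for A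
    proof -
      obtain j where j: "j < 2 * L" "A = 2 ^ j" using A(1) unfolding sector_1 by blast
      with A(2) have "j \<noteq> 2 * L - 1" by auto
      from step_right_pos[OF \<open>0 < c\<close> j(1) this] obtain k where
        k: "j < k" "k < 2 * L" "0 < step (2 ^ j) (2 ^ k)" by blast
      then have "(2::nat) ^ j < 2 ^ k" "(2::nat) ^ j < 2 ^ (2 * L)" by simp_all
      then have "(2::nat) ^ (2 * L) - 2 ^ k < 2 ^ (2 * L) - 2 ^ j" by (rule diff_less_mono2)
      moreover have "2 ^ k \<in> sector 1" unfolding sector_1 using k(2) by (intro imageI) simp
      ultimately show ?thesis using k(3) unfolding j(2) by (intro bexI[of _ "2 ^ k"] conjI)
    qed
    moreover have "2 ^ (2 * L - 1) \<in> sector 1" unfolding sector_1 using L_pos by (intro imageI) auto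
    ultimately show ?thesis by (intro bexI[of _ "2 ^ (2 * L - 1)"] exI[of _ "\<lambda>A. 2 ^ (2 * L) - A"]) auto
  qed
  then obtain z and rank :: "nat \<Rightarrow> nat" where z: "z \<in> sector 1" and
    descent: "\<And>A. A \<in> sector 1 \<Longrightarrow> A \<noteq> z \<Longrightarrow> \<exists>B\<in>sector 1. rank B < rank A \<and> 0 < step A B"
    by blast
  have "0 < step z z"
    using z step_stay \<epsilon>_pos unfolding sector_1 by (fastforce intro: less_le_trans[OF mult_pos_pos])
  then show ?thesis
    unfolding one_particle_trace_eq using growth_pos
    by (intro trace_kernel_power_asymp[where v = "weight 0" and rank = rank, OF finite_sector z])
       (auto simp: step_nonneg weight_pos step_weight_one_particle[simplified] intro: descent[simplified])
qed

lemma one_particle_trace_le: "one_particle_trace t \<le> 2 * L * (growth\<^sup>2) ^ t"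
proof -
  have "one_particle_trace t \<le> (\<Sum>x<2 * L. (growth\<^sup>2) ^ t)"
    unfolding one_particle_trace_def
  proof (intro sum_mono)
    fix x assume "x \<in> {..<2 * L}"
    then have "(2::nat) ^ x \<in> states" "num (2 ^ x) = 1" by (simp_all add: particle_number_single)
    then show "kernel_power states step t (2 ^ x) (2 ^ x) \<le> (growth\<^sup>2) ^ t"
      by (intro kernel_power_sector_le) (simp_all only: step_weight_one_particle order_refl zero_le_power2)
  qed
  then show ?thesis by simp
qed

lemma one_particle_trace_nonneg: "0 \<le> one_particle_trace t"
  unfolding one_particle_trace_def
  by (intro sum_nonneg kernel_power_nonneg step_nonneg) auto

text \<open>This permits division by the one-particle trace even when \<open>a\<close> and
  \<open>c\<close> both vanish. In that case the sites are not connected by hops, but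
  \<open>growth\<^sup>2\<close> equals \<open>\<epsilon>1 * \<epsilon>2\<close> and the return
  weight of one site suffices.\<close>

lemma one_particle_trace_lower:
  obtains k where "0 < k" "\<forall>\<^sub>F t in sequentially. k * (growth\<^sup>2) ^ t \<le> one_particle_trace t"
proof (cases "0 < a + c")
  case True
  have "\<forall>\<^sub>F t in sequentially. 1 / 2 < one_particle_trace t / (growth\<^sup>2) ^ t"
    by (rule order_tendstoD(1)[OF one_particle_trace_asymp[OF True]]) simp
  then have "\<forall>\<^sub>F t in sequentially. 1 / 2 * (growth\<^sup>2) ^ t \<le> one_particle_trace t"
    by eventually_elim (use growth_pos in \<open>simp add: field_simps\<close>)
  then show ?thesis by (intro that[of "1 / 2"]) simp
next
  case False
  then have "a = 0" "c = 0" using a_nonneg c_nonneg by linarith+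
  then have growth: "growth\<^sup>2 = \<epsilon>1 * \<epsilon>2" using growth_eq by (simp add: power2_eq_square)
  have "1 * (growth\<^sup>2) ^ t \<le> one_particle_trace t" for t
  proof -
    have "(1::nat) < 2 ^ (2 * L)" using L_pos by (intro one_less_power) auto
    then have state: "2 ^ 0 \<in> states" by simp
    have "(growth\<^sup>2) ^ t \<le> step (2 ^ 0) (2 ^ 0) ^ t"
      unfolding growth using step_stay[of 0] L_pos \<epsilon>_pos by (intro power_mono) auto
    also have "\<dots> \<le> kernel_power states step t (2 ^ 0) (2 ^ 0)"
      using state by (intro power_diag_le_kernel_power step_nonneg finite_lessThan)
    also have "\<dots> \<le> one_particle_trace t"
      unfolding one_particle_trace_def using L_pos
      by (intro member_le_sum[where f = "\<lambda>x. kernel_power states step t (2 ^ x) (2 ^ x)"])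
         (auto intro!: kernel_power_nonneg step_nonneg)
    finally show ?thesis by simp
  qed
  then show ?thesis by (intro that[of 1]) simp_all
qed

section \<open>The vacuum and the many-particle remainder\<close>

lemma kernel_power_vacuum: "kernel_power states step t 0 0 = 1"
proof -
  note num = particle_number_0[of L]
  have "sector 0 = {0}"
    using particle_number_eq_0[of _ L] num by (auto simp: sector_def)
  moreover have "lt' l 0 0 = 1" for l
    using entries(1) by (simp add: layer_transfer_def conserving_def pair_state_def)
  then have "step 0 0 = (\<Sum>C\<in>states. if C = 0 then 1 else 0)"
    unfolding step_eq_conserving[OF refl]
    using lt'_nonzero(1)[of 0 0] num particle_number_eq_0[of _ L]
    by (intro sum.cong refl) fastforce
  then have "step 0 0 = 1" by simp
  then have "kernel_power {0} step t 0 0 = 1"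
    by (induction t) auto
  ultimately show ?thesis using kernel_power_sector[of 0 t] num by simp
qed

text \<open>The vacuum and the one-particle block account for the subtracted terms; at most
  \<open>2 ^ (2 * L)\<close> states remain, each with return weight at most
  \<open>\<mu> ^ t\<close>.\<close>

lemma total_trace_bounds:
  assumes "growth\<^sup>2 < 1" "g < 1"
    and "growth\<^sup>2 * growth\<^sup>2 \<le> \<mu>" "growth\<^sup>2 * g \<le> \<mu>" "g ^ (2 * L) \<le> \<mu>"
  shows "0 \<le> (\<Sum>A\<in>states. kernel_power states step t A A) - 1 - one_particle_trace t"
    and "(\<Sum>A\<in>states. kernel_power states step t A A) - 1 - one_particle_trace t \<le> 2 ^ (2 * L) * \<mu> ^ t"
proof -
  let ?k = "\<lambda>A. kernel_power states step t A A"
  let ?many = "{A \<in> states. 2 \<le> num A}"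
  have "states = {0} \<union> (sector 1 \<union> ?many)"
    using particle_number_eq_0[of _ L] by (force simp: sector_def)
  moreover have "{0} \<inter> (sector 1 \<union> ?many) = {}" "sector 1 \<inter> ?many = {}"
    by (auto simp: sector_def particle_number_0)
  ultimately have "sum ?k states = ?k 0 + (sum ?k (sector 1) + sum ?k ?many)"
    using finite_sector[of 1] by (metis (no_types, lifting) finite.emptyI finite.insertI finite_Un
        finite_lessThan sum.union_disjoint sum.empty sum.insert add.right_neutral empty_iff)
  moreover have "sum ?k (sector 1) = one_particle_trace t"
    unfolding one_particle_trace_def sector_1 by (simp add: sum.reindex inj_on_def)
  ultimately have split: "sum ?k states - 1 - one_particle_trace t = sum ?k ?many"
    by (simp add: kernel_power_vacuum)
  show "0 \<le> sum ?k states - 1 - one_particle_trace t"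
    unfolding split by (intro sum_nonneg kernel_power_nonneg step_nonneg) auto
  have "0 \<le> \<mu>" using assms(3) zero_le_square[of "growth\<^sup>2"] by linarith
  have "sum ?k ?many \<le> (\<Sum>A\<in>?many. \<mu> ^ t)"
    using assms by (intro sum_mono kernel_power_many_particles_le) auto
  also have "\<dots> = card ?many * \<mu> ^ t" by simp
  also have "\<dots> \<le> 2 ^ (2 * L) * \<mu> ^ t"
  proof (rule mult_right_mono)
    have "card ?many \<le> card states" by (rule card_mono) auto
    then have "card ?many \<le> 2 ^ (2 * L)" by simp
    then show "real (card ?many) \<le> 2 ^ (2 * L)"
      by (metis of_nat_le_iff of_nat_numeral of_nat_power)
  qed (use \<open>0 \<le> \<mu>\<close> in simp)
  finally show "sum ?k states - 1 - one_particle_trace t \<le> 2 ^ (2 * L) * \<mu> ^ t"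
    unfolding split .
qed

text \<open>All competing rates are strictly below \<open>growth\<^sup>2\<close>: two independent
  particles, particles meeting in gates, and the full ring, for which this is the third
  hypothesis.\<close>

lemma many_particle_trace_negligible:
  assumes "growth\<^sup>2 < 1" "g < 1" "g ^ (2 * L) < growth\<^sup>2"
  shows "(\<lambda>t. ((\<Sum>A\<in>states. kernel_power states step t A A) - 1 - one_particle_trace t)
    / one_particle_trace t) \<longlonglongrightarrow> 0"
proof -
  let ?R = "\<lambda>t. (\<Sum>A\<in>states. kernel_power states step t A A) - 1 - one_particle_trace t"
  define \<mu> where "\<mu> = Max {growth\<^sup>2 * growth\<^sup>2, growth\<^sup>2 * g, g ^ (2 * L)}"
  have "0 < growth\<^sup>2" using growth_pos by simp
  then have "growth\<^sup>2 * growth\<^sup>2 < growth\<^sup>2 * 1" "growth\<^sup>2 * g < growth\<^sup>2 * 1"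
    using assms(1,2) by (simp_all only: mult_less_cancel_left_pos)
  then have \<mu>: "\<mu> < growth\<^sup>2" using assms(3) by (simp add: \<mu>_def)
  have le: "growth\<^sup>2 * growth\<^sup>2 \<le> \<mu>" "growth\<^sup>2 * g \<le> \<mu>" "g ^ (2 * L) \<le> \<mu>"
    by (simp_all add: \<mu>_def)
  have "0 \<le> \<mu>" using le(1) zero_le_square[of "growth\<^sup>2"] by linarith
  note bounds = total_trace_bounds[OF assms(1,2) le]
  obtain k where k: "0 < k" "\<forall>\<^sub>F t in sequentially. k * (growth\<^sup>2) ^ t \<le> one_particle_trace t"
    by (rule one_particle_trace_lower)
  have "(\<lambda>t. (\<mu> / growth\<^sup>2) ^ t) \<longlonglongrightarrow> 0"
    using \<mu> \<open>0 \<le> \<mu>\<close> \<open>0 < growth\<^sup>2\<close> by (intro LIMSEQ_realpow_zero) simp_all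
  then have "(\<lambda>t. 2 ^ (2 * L) / k * (\<mu> / growth\<^sup>2) ^ t) \<longlonglongrightarrow> 0"
    by (rule tendsto_mult_right_zero)
  moreover have "\<forall>\<^sub>F t in sequentially.
      norm (?R t / one_particle_trace t) \<le> 2 ^ (2 * L) / k * (\<mu> / growth\<^sup>2) ^ t"
    using k(2)
  proof eventually_elim
    case (elim t)
    have pos: "0 < k * (growth\<^sup>2) ^ t" using k(1) \<open>0 < growth\<^sup>2\<close> by simp
    have "?R t / one_particle_trace t \<le> 2 ^ (2 * L) * \<mu> ^ t / (k * (growth\<^sup>2) ^ t)"
      using bounds[of t] elim pos \<open>0 \<le> \<mu>\<close> by (intro frac_le) auto
    moreover have "0 \<le> ?R t / one_particle_trace t"
      using bounds(1)[of t] one_particle_trace_nonneg by (rule divide_nonneg_nonneg)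
    ultimately show ?case by (simp add: power_divide)
  qed
  ultimately show ?thesis by (rule Lim_null_comparison[rotated])
qed

end

section \<open>Asymptotics of the spectral form factor\<close>

theorem mainTheorem2:
  fixes U :: "complex mat"
    and a b c d e f g \<epsilon>1 \<epsilon>2 lam \<tau> :: real
    and L :: nat
  assumes "unitary_mat 4 U"
    and "averaged_gate U = mat_of_rows_list 4
           [[1, 0,  0,  0],
            [0, \<epsilon>1, a,  b],
            [0, c,  \<epsilon>2, d],
            [0, e,  f,  g]]"
    and "0 \<le> a" "0 \<le> b" "0 \<le> c" "0 \<le> d" "0 \<le> e" "0 \<le> f" "0 \<le> g"
    and "0 < \<epsilon>1" "0 < \<epsilon>2"
    and "(e = 0 \<and> f = 0) \<or> (b = 0 \<and> d = 0)"
    and "lam = 1 / 4 * ((a + c) + sqrt (4 * \<epsilon>1 * \<epsilon>2 + (a - c)\<^sup>2))\<^sup>2"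
    and "lam * max 1 (g / (\<epsilon>1 * \<epsilon>2 + a * c)) < 1"
    and "inverse \<tau> = - ln lam"
    and "1 \<le> L"
    and "no_conserved_charges U L"
  shows "max (a\<^sup>2) (c\<^sup>2) < lam
    \<and> (g ^ (2 * L) < lam \<longrightarrow>
         spectral_form_factor U L \<simeq> (\<lambda>t. 1 + one_point_sff U L t))
    \<and> (0 < a + c \<longrightarrow>
         (\<lambda>t. 1 + one_point_sff U L t)
           \<simeq> (\<lambda>t. 1 + lam ^ t + (a ^ (2 * t) + c ^ (2 * t)) * real L * of_bool (t mod L = 0)))
    \<and> (g ^ (2 * L) < lam \<and> 0 < a + c \<longrightarrow>
         spectral_form_factor U L \<simeq> (\<lambda>t. 1 + exp (- real t / \<tau>)))
    \<and> (\<forall>\<^sub>F M in sequentially. g ^ (2 * M) < lam)"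
proof -
  define w where "w = (\<lambda>r s. averaged_gate U $$ (r, s))"
  \<comment> \<open>If there are neither splittings nor mergers, both signs are admissible and 1 is
    chosen.\<close>
  define \<kappa> :: int where "\<kappa> = (if e = 0 \<and> f = 0 then 1 else - 1)"
  have U: "U \<in> carrier_mat 4 4" using assms(1) by (simp add: unitary_mat_def)
  have w: "w 0 0 = 1" "w 0 1 = 0" "w 0 2 = 0" "w 0 3 = 0"
    "w 1 0 = 0" "w 1 1 = \<epsilon>1" "w 1 2 = a" "w 1 3 = b"
    "w 2 0 = 0" "w 2 1 = c" "w 2 2 = \<epsilon>2" "w 2 3 = d"
    "w 3 0 = 0" "w 3 1 = e" "w 3 2 = f" "w 3 3 = g"
    by (simp_all add: w_def assms(2) mat_of_rows_list_def)
  interpret directed_gate L w a c g \<epsilon>1 \<epsilon>2 \<kappa>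
  proof
    fix r s :: nat assume rs: "r < 4" "s < 4"
    then have cases: "r = 0 \<or> r = 1 \<or> r = 2 \<or> r = 3" "s = 0 \<or> s = 1 \<or> s = 2 \<or> s = 3"
      by (simp_all only: less_4_cases)
    show "0 \<le> w r s" using cases assms(3-11) by (elim disjE) (simp_all only: w order_refl zero_le_one less_imp_le)
    show "\<kappa> * int (occupancy r) \<le> \<kappa> * int (occupancy s)" if "w r s \<noteq> 0"
      using cases assms(12) that
      by (elim disjE) (simp_all only: w, simp_all add: \<kappa>_def occupancy_def)
  qed (use assms(10,11,16) in \<open>simp_all only: w \<kappa>_def\<close>, simp_all)
  have lam: "lam = growth\<^sup>2"
    unfolding assms(13) growth_def by (simp add: power_divide)
  have lam_pos: "0 < lam" unfolding lam using growth_pos by simp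
  have max_lt: "max (a\<^sup>2) (c\<^sup>2) < lam"
    unfolding lam using growth_gt a_nonneg c_nonneg by (simp add: power_strict_mono)
  have "lam * 1 \<le> lam * max 1 (g / (\<epsilon>1 * \<epsilon>2 + a * c))"
    "lam * (g / (\<epsilon>1 * \<epsilon>2 + a * c)) \<le> lam * max 1 (g / (\<epsilon>1 * \<epsilon>2 + a * c))"
    using lam_pos by (intro mult_left_mono; simp)+
  then have lam_lt: "lam < 1" and "lam * (g / (\<epsilon>1 * \<epsilon>2 + a * c)) < 1"
    using assms(14) by linarith+
  moreover have "0 < \<epsilon>1 * \<epsilon>2 + a * c"
    using assms(3,5,10,11) by (simp add: add_pos_nonneg)
  ultimately have "lam * g < \<epsilon>1 * \<epsilon>2 + a * c"
    by (simp add: field_simps)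
  also have "\<dots> \<le> lam"
  proof -
    \<comment> \<open>By \<open>growth_eq\<close>, the difference of \<open>lam\<close> and
      \<open>\<epsilon>1 * \<epsilon>2 + a * c\<close> is
      \<open>growth * (a + c) - 2 * a * c\<close>, which these two bounds make nonnegative.\<close>
    have "a * c \<le> growth * c" "a * c \<le> a * growth"
      using growth_gt a_nonneg c_nonneg by (auto intro: mult_right_mono mult_left_mono)
    then show ?thesis
      unfolding lam using growth_eq by (simp add: algebra_simps power2_eq_square)
  qed
  finally have g_lt: "g < 1" using lam_pos by simp
  let ?K1 = "one_point_sff U L" and ?K = "spectral_form_factor U L"
  have K1: "?K1 t = one_particle_trace t" for t
    unfolding one_particle_trace_def unfolding w_def by (rule one_point_sff_eq_trace[OF L_pos U])
  have K: "?K t = (\<Sum>A\<in>states. kernel_power states step t A A)" if "0 < t" for t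
    unfolding w_def by (rule spectral_form_factor_eq_trace[OF L_pos U that])
  have lam_lim: "(\<lambda>t. lam ^ t) \<longlonglongrightarrow> 0"
    using lam_pos lam_lt by (intro LIMSEQ_realpow_zero) auto
  have K1_lim: "?K1 \<longlonglongrightarrow> 0"
  proof (rule tendsto_sandwich[OF _ _ tendsto_const])
    show "(\<lambda>t. 2 * L * lam ^ t) \<longlonglongrightarrow> 0"
      by (rule tendsto_mult_right_zero[OF lam_lim])
    show "\<forall>\<^sub>F t in sequentially. ?K1 t \<le> 2 * L * lam ^ t"
      using one_particle_trace_le by (simp add: K1 lam)
  qed (simp add: K1 one_particle_trace_nonneg)
  \<comment> \<open>Without hops the one-particle block is \<open>lam\<close> times the identity,
    with trace \<open>2 * L * lam ^ t\<close>; hence the condition on \<open>a + c\<close>.\<close>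
  have K1_asymp: "?K1 \<sim>[at_top] (\<lambda>t. lam ^ t)" if "0 < a + c"
    using one_particle_trace_asymp[OF that] by (intro asymp_equivI') (simp add: K1 lam)
  \<comment> \<open>The fully occupied ring is a single state with return weight
    \<open>g ^ (2 * L)\<close> per step; the condition keeps it subleading.\<close>
  have K_asymp: "(\<lambda>t. ?K t - 1) \<sim>[at_top] ?K1" if "g ^ (2 * L) < lam"
  proof (rule asymp_equivI')
    obtain k where k: "0 < k" "\<forall>\<^sub>F t in sequentially. k * (growth\<^sup>2) ^ t \<le> one_particle_trace t"
      by (rule one_particle_trace_lower)
    have "(\<lambda>t. 1 + ((\<Sum>A\<in>states. kernel_power states step t A A) - 1 - one_particle_trace t)
        / one_particle_trace t) \<longlonglongrightarrow> 1 + 0"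
      using lam_lt g_lt that unfolding lam by (intro tendsto_intros many_particle_trace_negligible)
    moreover have "\<forall>\<^sub>F t in sequentially.
        1 + ((\<Sum>A\<in>states. kernel_power states step t A A) - 1 - one_particle_trace t) / one_particle_trace t
        = (?K t - 1) / ?K1 t"
      \<comment> \<open>The lower bound makes the denominator nonzero, and \<open>K\<close> is
        available for positive times.\<close>
      using k(2) eventually_gt_at_top[of 0]
    proof eventually_elim
      case (elim t)
      have "0 < k * (growth\<^sup>2) ^ t" using k(1) growth_pos by simp
      then have "one_particle_trace t \<noteq> 0" using elim(1) by linarith
      then show ?case using elim(2) by (simp add: K K1 field_simps)
    qed
    ultimately show "(\<lambda>t. (?K t - 1) / ?K1 t) \<longlonglongrightarrow> 1"
      by (simp add: tendsto_cong)
  qed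
  have K_lim: "?K \<longlonglongrightarrow> 1" if "g ^ (2 * L) < lam"
  proof -
    have "(\<lambda>t. ?K t - 1) \<longlonglongrightarrow> 0"
      using K_asymp[OF that] K1_lim by (simp add: tendsto_asymp_equiv_cong)
    then show ?thesis by (rule LIM_zero_cancel)
  qed
  define h where "h = (\<lambda>t. lam ^ t + (a ^ (2 * t) + c ^ (2 * t)) * real L * of_bool (t mod L = 0))"
  \<comment> \<open>The terms that recur with period \<open>L\<close> are negligible since
    \<open>a\<^sup>2\<close> and \<open>c\<^sup>2\<close> lie below \<open>lam\<close>.\<close>
  have h_asymp: "h \<sim>[at_top] (\<lambda>t. lam ^ t)"
  proof (rule asymp_equivI')
    have lim: "(\<lambda>t. (x\<^sup>2 / lam) ^ t) \<longlonglongrightarrow> 0" if "x\<^sup>2 < lam" for x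
      using that lam_pos by (intro LIMSEQ_realpow_zero) simp_all
    have "(\<lambda>t. ((a\<^sup>2 / lam) ^ t + (c\<^sup>2 / lam) ^ t) * real L) \<longlonglongrightarrow> (0 + 0) * real L"
      using max_lt by (intro tendsto_intros lim) simp_all
    then have sum_lim: "(\<lambda>t. ((a\<^sup>2 / lam) ^ t + (c\<^sup>2 / lam) ^ t) * real L) \<longlonglongrightarrow> 0" by simp
    have "(\<lambda>t. ((a\<^sup>2 / lam) ^ t + (c\<^sup>2 / lam) ^ t) * real L * of_bool (t mod L = 0)) \<longlonglongrightarrow> 0"
      by (rule Lim_null_comparison[OF always_eventually sum_lim]) (use lam_pos in \<open>simp add: abs_mult\<close>)
    then have "(\<lambda>t. 1 + ((a\<^sup>2 / lam) ^ t + (c\<^sup>2 / lam) ^ t) * real L * of_bool (t mod L = 0)) \<longlonglongrightarrow> 1 + 0"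
      by (intro tendsto_intros)
    moreover have "h t / lam ^ t = 1 + ((a\<^sup>2 / lam) ^ t + (c\<^sup>2 / lam) ^ t) * real L * of_bool (t mod L = 0)" for t
      using lam_pos by (simp add: h_def power_mult power_divide add_divide_distrib distrib_right)
    ultimately show "(\<lambda>t. h t / lam ^ t) \<longlonglongrightarrow> 1" by simp
  qed
  have h_lim: "h \<longlonglongrightarrow> 0"
    using h_asymp lam_lim by (simp add: tendsto_asymp_equiv_cong)
  have exp: "exp (- real t / \<tau>) = lam ^ t" for t
  proof -
    have "exp (- real t / \<tau>) = exp (real t * ln lam)"
      using assms(15) by (simp add: divide_inverse)
    also have "\<dots> = lam ^ t" using lam_pos by (simp add: exp_of_nat_mult)
    finally show ?thesis .
  qed
  have one_add: "(\<lambda>t. 1 + u t) \<longlonglongrightarrow> 1" if "u \<longlonglongrightarrow> 0" for u :: "nat \<Rightarrow> real"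
    using tendsto_add[OF tendsto_const[of 1] that] by simp
  have "?K \<simeq> (\<lambda>t. 1 + ?K1 t)" if "g ^ (2 * L) < lam"
    unfolding asymp_eq_subleading_def using K_lim[OF that] K_asymp[OF that] one_add[OF K1_lim] by simp
  moreover have "(\<lambda>t. 1 + ?K1 t)
      \<simeq> (\<lambda>t. 1 + lam ^ t + (a ^ (2 * t) + c ^ (2 * t)) * real L * of_bool (t mod L = 0))" if "0 < a + c"
  proof -
    have "?K1 \<sim>[at_top] h"
      by (rule asymp_equiv_trans[OF K1_asymp[OF that] asymp_equiv_symI[OF h_asymp]])
    then have "(\<lambda>t. 1 + ?K1 t) \<simeq> (\<lambda>t. 1 + h t)"
      unfolding asymp_eq_subleading_def using one_add[OF K1_lim] one_add[OF h_lim] by simp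
    then show ?thesis by (simp add: h_def add.assoc)
  qed
  moreover have "?K \<simeq> (\<lambda>t. 1 + exp (- real t / \<tau>))" if "g ^ (2 * L) < lam" "0 < a + c"
    unfolding asymp_eq_subleading_def exp
    using K_lim[OF that(1)] one_add[OF lam_lim] asymp_equiv_trans[OF K_asymp[OF that(1)] K1_asymp[OF that(2)]]
    by simp
  \<comment> \<open>Neither \<open>g < 1\<close> nor \<open>lam\<close> depends on the length, so
    the condition on the full ring holds for all large rings.\<close>
  moreover have "\<forall>\<^sub>F M in sequentially. g ^ (2 * M) < lam"
  proof -
    have "g\<^sup>2 < 1" using g_lt g_nonneg by (simp add: power_less_one_iff)
    then have "(\<lambda>M. (g\<^sup>2) ^ M) \<longlonglongrightarrow> 0" by (intro LIMSEQ_realpow_zero) auto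
    then show ?thesis unfolding power_mult by (rule order_tendstoD(2)) (rule lam_pos)
  qed
  ultimately show ?thesis using max_lt by blast
qed

end
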